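(* Let $\Phi$ denote the fine-grid time-stepping operator and $\Psi$ the coarse-grid time-stepping operator, for all time points (invertible, linear, time-independent $N_x\times N_x$ matrices with $\|\Phi^q\|,\|\Psi^q\|<1$ for some $q$), with coarsening factor $k$, and $N_c$ time points on the coarse grid. Assume that $\Phi$ and $\Psi$ commute and are diagonalizable, with eigenvectors given as columns of $U$, and that $\Phi$ satisfies an F-TEAP with respect to $\Psi$, with constant $\varphi_F<1$. Let $\mathbf{e}_{p+1}$ denote the error vector of Parareal / two-level MGRiT with F-relaxation after $p+1$ iterations. Then $\|\mathbf{e}_1\|_{(UU^* )^{-1}}^2\le k\|\mathbf{e}_0\|_{(UU^* )^{-1}}^2$, and $$\|\mathbf{e}_{p+1}\|_{(UU^* )^{-1}}^2\le\left(\varphi_F^{2p}-O(1/N_c^2)\right)\|\mathbf{e}_1\|_{(UU^* )^{-1}}^2 .$$ Furthermore, this bound is tight; that is, there exists an initial error $\mathbf{e}_0$ such that the last inequality holds with equality, to $O(1/N_c^2)$. This also provides necessary and sufficient (asymptotic) conditions for convergence in the $\ell^2$- and $A^*A$-norms. That is, iterations may diverge at first, but will eventually converge in the $\ell^2$- and $A^*A$-norms.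
   Context: F-TEAP (F-relaxation temporal eigenvalue approximation property): let $\{\lambda_\ell\}$ and $\{\mu_\ell\}$ be the eigenvalues of $\Phi$ and $\Psi$, with $\Phi\mathbf{u}_\ell=\lambda_\ell\mathbf{u}_\ell$, $\Psi\mathbf{u}_\ell=\mu_\ell\mathbf{u}_\ell$ for the columns $\mathbf{u}_\ell$ of $U$. $\Phi$ satisfies an F-TEAP with respect to $\Psi$ with constant $\varphi_F$ if $|\mu_\ell-\lambda_\ell^k|\le\varphi_F(1-|\mu_\ell|)$ for $\ell=0,\dots,N_x-1$. Norms: for a space-time vector $\mathbf{x}$ with blocks $\mathbf{x}_j\in\mathbb{C}^{N_x}$ (one per time point), $\|\mathbf{x}\|_{(UU^* )^{-1}}^2=\sum_j\|U^{-1}\mathbf{x}_j\|^2$; $\|\mathbf{x}\|_{A^*A}=\|A\mathbf{x}\|$, with $\|\cdot\|$ the Euclidean ($\ell^2$) norm. Algorithm: there are $N=(N_c-1)k+1$ time points $0,\dots,N-1$. $A$ is the $N\times N$ block matrix with $N_x\times N_x$ blocks, identity blocks on the diagonal, $-\Phi$ on the first block subdiagonal, zeros elsewhere; the method iteratively solves $A\mathbf{u}=\mathbf{f}$. C-points are the time points that are multiples of $k$; all others are F-points. Ordering F-points first, $A=\begin{bmatrix} A_{ff} & A_{fc} \\ A_{cf} & A_{cc} \end{bmatrix}$; $A_\Delta=A_{cc}-A_{cf}A_{ff}^{-1}A_{fc}$; $B_\Delta$ is the $N_c\times N_c$ block matrix with identity diagonal blocks, $-\Psi$ on the first block subdiagonal,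 zeros elsewhere. The error (exact solution minus iterate) propagates as $\mathbf{e}_{i+1}=\mathcal{E}_F\mathbf{e}_i$, where $$\mathcal{E}_F=\begin{bmatrix} -A_{ff}^{-1}A_{fc} \\ I \end{bmatrix}\begin{bmatrix} 0 & I-B_\Delta^{-1}A_\Delta \end{bmatrix}.$$ Convention: $O(1/N_c^2)$ denotes a positive term of that order as $N_c$ grows, $\Phi$ and $\Psi$ being independent of $N_c$.
   Formalization: The second bound and its tightness are stated for p ≥ 1 (for p = 0 a positive O(1/N_c^2) term makes the bound false), and tightness is stated for N_c ≥ 2 with φ_F the smallest constant for which the F-TEAP holds (it fails for larger constants). *)

theory Defs
  imports "HOL-Analysis.Analysis" "HOL-Library.Landau_Symbols"
begin

text \<open>The number of time points varies inside the statements, so block matrices are functions of two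
  natural-number block indices and all products and inverses are taken relative to an explicit finite
  index set. The block size, i.e. the spatial dimension, is the cardinality of the type \<open>'n\<close>.\<close>

type_synonym 'n block_matrix = "nat \<Rightarrow> nat \<Rightarrow> complex^'n^'n"
type_synonym 'n block_vector = "nat \<Rightarrow> complex^'n"

definition block_id :: "'n::finite block_matrix" where
  "block_id i j = (if i = j then mat 1 else 0)"

definition block_mult ::
  "nat set \<Rightarrow> 'n::finite block_matrix \<Rightarrow> 'n block_matrix \<Rightarrow> 'n block_matrix" where
  "block_mult S X Y i j = (\<Sum>l\<in>S. X i l ** Y l j)"

definition block_apply ::
  "nat set \<Rightarrow> 'n::finite block_matrix \<Rightarrow> 'n block_vector \<Rightarrow> 'n block_vector" where
  "block_apply S X v i = (\<Sum>l\<in>S. X i l *v v l)"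

text \<open>Only the blocks with both indices in \<open>S\<close> are determined (and meaningful).\<close>

definition block_inv :: "nat set \<Rightarrow> 'n::finite block_matrix \<Rightarrow> 'n block_matrix" where
  "block_inv S X = (SOME Y. \<forall>i\<in>S. \<forall>j\<in>S.
     block_mult S X Y i j = block_id i j \<and> block_mult S Y X i j = block_id i j)"

text \<open>\<open>bidiag \<Phi>\<close> on \<open>{..<num_points k Nc}\<close> is the fine-grid matrix \<open>A\<close>;
  \<open>bidiag \<Psi>\<close> on \<open>{..<Nc}\<close> is the coarse-grid matrix \<open>B\<^sub>\<Delta>\<close>.\<close>

definition bidiag :: "complex^'n^'n \<Rightarrow> 'n::finite block_matrix" where
  "bidiag M i j = (if i = j then mat 1 else if i = Suc j then - M else 0)"

definition num_points :: "nat \<Rightarrow> nat \<Rightarrow> nat" where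
  "num_points k Nc = (Nc - 1) * k + 1"

definition F_points :: "nat \<Rightarrow> nat \<Rightarrow> nat set" where
  "F_points k Nc = {i. i < num_points k Nc \<and> \<not> k dvd i}"

text \<open>F-points are indexed by their time point, C-points by their coarse index: the coarse index
  \<open>a < Nc\<close> stands for the time point \<open>a * k\<close>.\<close>

definition A_ff :: "complex^'n^'n \<Rightarrow> 'n::finite block_matrix" where
  "A_ff \<Phi> i j = bidiag \<Phi> i j"

definition A_fc :: "nat \<Rightarrow> complex^'n^'n \<Rightarrow> 'n::finite block_matrix" where
  "A_fc k \<Phi> i b = bidiag \<Phi> i (b * k)"

definition A_cf :: "nat \<Rightarrow> complex^'n^'n \<Rightarrow> 'n::finite block_matrix" where
  "A_cf k \<Phi> a j = bidiag \<Phi> (a * k) j"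

definition A_cc :: "nat \<Rightarrow> complex^'n^'n \<Rightarrow> 'n::finite block_matrix" where
  "A_cc k \<Phi> a b = bidiag \<Phi> (a * k) (b * k)"

definition Aff_inv_Afc :: "nat \<Rightarrow> nat \<Rightarrow> complex^'n^'n \<Rightarrow> 'n::finite block_matrix" where
  "Aff_inv_Afc k Nc \<Phi> =
     block_mult (F_points k Nc) (block_inv (F_points k Nc) (A_ff \<Phi>)) (A_fc k \<Phi>)"

definition A_Delta :: "nat \<Rightarrow> nat \<Rightarrow> complex^'n^'n \<Rightarrow> 'n::finite block_matrix" where
  "A_Delta k Nc \<Phi> a b =
     A_cc k \<Phi> a b - block_mult (F_points k Nc) (A_cf k \<Phi>) (Aff_inv_Afc k Nc \<Phi>) a b"

definition coarse_propagator ::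
  "nat \<Rightarrow> nat \<Rightarrow> complex^'n^'n \<Rightarrow> complex^'n^'n \<Rightarrow> 'n::finite block_matrix" where
  "coarse_propagator k Nc \<Phi> \<Psi> a b =
     block_id a b -
     block_mult {..<Nc} (block_inv {..<Nc} (bidiag \<Psi>)) (A_Delta k Nc \<Phi>) a b"

text \<open>The two factors of the error propagator: the block column
  \<open>[- A\<^sub>f\<^sub>f\<^sup>-\<^sup>1 A\<^sub>f\<^sub>c; I]\<close> and the block row \<open>[0, I - B\<^sub>\<Delta>\<^sup>-\<^sup>1 A\<^sub>\<Delta>]\<close>. The fine index is a time point and
  is not permuted; whether \<open>k\<close> divides it selects the F- or the C-part.\<close>

definition ideal_interpolation :: "nat \<Rightarrow> nat \<Rightarrow> complex^'n^'n \<Rightarrow> 'n::finite block_matrix" where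
  "ideal_interpolation k Nc \<Phi> i a =
     (if k dvd i then block_id (i div k) a else - Aff_inv_Afc k Nc \<Phi> i a)"

definition coarse_row ::
  "nat \<Rightarrow> nat \<Rightarrow> complex^'n^'n \<Rightarrow> complex^'n^'n \<Rightarrow> 'n::finite block_matrix" where
  "coarse_row k Nc \<Phi> \<Psi> a j =
     (if k dvd j then coarse_propagator k Nc \<Phi> \<Psi> a (j div k) else 0)"

definition E_F ::
  "nat \<Rightarrow> nat \<Rightarrow> complex^'n^'n \<Rightarrow> complex^'n^'n \<Rightarrow> 'n::finite block_matrix" where
  "E_F k Nc \<Phi> \<Psi> =
     block_mult {..<Nc} (ideal_interpolation k Nc \<Phi>) (coarse_row k Nc \<Phi> \<Psi>)"

definition error_after ::
  "nat \<Rightarrow> nat \<Rightarrow> complex^'n^'n \<Rightarrow> complex^'n^'n \<Rightarrow> nat \<Rightarrow> 'n::finite block_vector \<Rightarrow> 'n block_vector"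
where
  "error_after k Nc \<Phi> \<Psi> p e0 =
     (block_apply {..<num_points k Nc} (E_F k Nc \<Phi> \<Psi>) ^^ p) e0"

definition l2_norm :: "nat \<Rightarrow> 'n::finite block_vector \<Rightarrow> real" where
  "l2_norm N x = L2_set (\<lambda>j. norm (x j)) {..<N}"

definition UU_norm :: "complex^'n^'n \<Rightarrow> nat \<Rightarrow> 'n::finite block_vector \<Rightarrow> real" where
  "UU_norm U N x = l2_norm N (\<lambda>j. matrix_inv U *v x j)"

definition AA_norm :: "complex^'n^'n \<Rightarrow> nat \<Rightarrow> 'n::finite block_vector \<Rightarrow> real" where
  "AA_norm \<Phi> N x = l2_norm N (block_apply {..<N} (bidiag \<Phi>) x)"

text \<open>The library's power on \<open>complex^'n^'n\<close> is componentwise, hence a separate matrix power.\<close>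

definition matrix_power :: "complex^'n^'n \<Rightarrow> nat \<Rightarrow> complex^'n^'n::finite" where
  "matrix_power M q = (((**) M) ^^ q) (mat 1)"

definition diagonalizes :: "complex^'n^'n \<Rightarrow> complex^'n^'n::finite \<Rightarrow> bool" where
  "diagonalizes U M \<longleftrightarrow> invertible U \<and> (\<forall>l. \<exists>c. M *v column l U = c *s column l U)"

definition time_stepping_pair ::
  "complex^'n^'n \<Rightarrow> complex^'n^'n \<Rightarrow> complex^'n^'n::finite \<Rightarrow> bool" where
  "time_stepping_pair \<Phi> \<Psi> U \<longleftrightarrow>
     invertible \<Phi> \<and> invertible \<Psi> \<and>
     (\<exists>q. onorm ((*v) (matrix_power \<Phi> q)) < 1 \<and> onorm ((*v) (matrix_power \<Psi> q)) < 1) \<and>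
     \<Phi> ** \<Psi> = \<Psi> ** \<Phi> \<and> diagonalizes U \<Phi> \<and> diagonalizes U \<Psi>"

definition F_TEAP ::
  "nat \<Rightarrow> complex^'n^'n \<Rightarrow> complex^'n^'n \<Rightarrow> complex^'n^'n::finite \<Rightarrow> real \<Rightarrow> bool" where
  "F_TEAP k \<Phi> \<Psi> U \<phi> \<longleftrightarrow>
     (\<exists>lam mu :: 'n \<Rightarrow> complex.
        (\<forall>l. \<Phi> *v column l U = lam l *s column l U \<and> \<Psi> *v column l U = mu l *s column l U) \<and>
        (\<forall>l. cmod (mu l - lam l ^ k) \<le> \<phi> * (1 - cmod (mu l))))"

text \<open>The convention for \<open>O(1/N\<^sub>c\<^sup>2)\<close>: a positive term of exactly that order.\<close>

definition order_term :: "(nat \<Rightarrow> real) \<Rightarrow> bool" where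
  "order_term \<epsilon> \<longleftrightarrow> (\<forall>Nc\<ge>1. 0 < \<epsilon> Nc) \<and> \<epsilon> \<in> \<Theta>(\<lambda>Nc. 1 / (real Nc)\<^sup>2)"

text \<open>Convergence of the iteration uniformly in the number of coarse points, for a family of norms
  \<open>nrm N\<close> on space-time vectors with \<open>N\<close> time points. For a fixed number of coarse points the
  propagator is nilpotent, so the error always vanishes after finitely many iterations;
  uniformity as \<open>N\<^sub>c\<close> grows is what makes the notion of (asymptotic) convergence non-trivial.\<close>

definition asymptotically_convergent ::
  "(nat \<Rightarrow> 'n::finite block_vector \<Rightarrow> real) \<Rightarrow> nat \<Rightarrow> complex^'n^'n \<Rightarrow> complex^'n^'n \<Rightarrow> bool" where
  "asymptotically_convergent nrm k \<Phi> \<Psi> \<longleftrightarrow>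
     (\<forall>\<epsilon>>0. \<exists>P. \<forall>p\<ge>P. \<forall>Nc\<ge>1. \<forall>e0.
        nrm (num_points k Nc) (error_after k Nc \<Phi> \<Psi> p e0) \<le> \<epsilon> * nrm (num_points k Nc) e0)"

end

(* In eigenvector coordinates the iteration decouples into scalar problems. On the C-points one
   iteration maps c to y with y_0 = 0 and y_(a+1) = mu y_a + (lam^k - mu) c_a, that is, it applies the
   truncated Toeplitz operator with symbol (lam^k - mu) z / (1 - mu z), and the F-points copy
   lam^r y_a.  For y_0 = 0 and mu = m u with |u| = 1, completing squares gives
     sum |y_(a+1) - mu y_a|^2 = (1-m)^2 sum |y_(a+1)|^2 + m (1-m) |y_n|^2 + m sum |y_(a+1) - u y_a|^2.
   A discrete Poincare inequality bounds the last sum below by n^-2 sum |y_(a+1)|^2, which yields the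
   contraction factor with its gain of order 1/Nc^2.  Running the recursion backwards from a
   triangular bump twisted by powers of u makes the same sum O(n^-2), which shows that the factor is
   attained up to that order and, since it is uniform in Nc, that phi < 1 is necessary. *)
theory Submission
  imports Defs
begin

section \<open>Block matrices and their inverses\<close>

text \<open>The norm with \<open>matrix_inv U\<close> is a sum over eigenmodes without cross terms,
  so the contraction factor is that of the worst mode. From the second iteration on both sides carry
  the same F-point weights; only the first compares them with the initial error, whose C-points
  count once, and this costs the factor k. The gain of order 1/Nc^2 needs a common positive lower
  bound for all |mu|, supplied by the invertibility of \<Psi> and the finiteness of the spectrum;
  for mu = 0 the sweep is a scaled shift. For sharpness the obstacle is that every sweep starts from
  0 at the first C-point. The bump therefore has p + 1 leading zeros, one for each backward step,
  and it ends in zeros, which removes both the boundary term |y_n|^2 and the exceptional weight of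
  the last C-point. Twisted differences commute with the backward step, so they stay small against
  the sequence throughout. Exact equality is not constructed: its order term is defined as the
  deviation of a slow error from phi^(2p) and squeezed between the two estimates. If phi = 0, the
  first iterate is already zero and equality is trivial.\<close>

lemma matrix_mult_sum_right: "(A :: complex^'n^'n) ** (\<Sum>i\<in>S. B i) = (\<Sum>i\<in>S. A ** B i)"
  by (induction S rule: infinite_finite_induct) (auto simp: matrix_add_ldistrib)

lemma matrix_mult_sum_left: "(\<Sum>i\<in>S. B i) ** (A :: complex^'n^'n) = (\<Sum>i\<in>S. B i ** A)"
  by (simp add: matrix_matrix_mult_def vec_eq_iff sum_distrib_right sum.swap[of _ S])

lemma matrix_mult_minus_left: "(- A) ** B = - (A ** (B :: complex^'n^'n))"
  by (simp add: matrix_matrix_mult_def vec_eq_iff sum_negf)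

lemma matrix_mult_minus_right: "A ** (- B) = - (A ** (B :: complex^'n^'n))"
  by (simp add: matrix_matrix_mult_def vec_eq_iff sum_negf)

lemma matrix_mult_diff_right: "A ** (B - C) = A ** B - A ** (C :: complex^'n^'n)"
  by (simp add: matrix_matrix_mult_def vec_eq_iff algebra_simps sum_subtractf)

lemma matrix_vector_mult_minus_left: "(- A) *v x = - ((A :: complex^'n^'n) *v x)"
  by (simp add: matrix_vector_mult_def vec_eq_iff sum_negf)

lemma matrix_vector_mult_sum: "(A :: complex^'n^'n) *v (\<Sum>i\<in>S. f i) = (\<Sum>i\<in>S. A *v f i)"
  by (induction S rule: infinite_finite_induct) (auto simp: matrix_vector_right_distrib)

lemma matrix_power_0 [simp]: "matrix_power M 0 = mat 1"
  and matrix_power_Suc [simp]: "matrix_power M (Suc q) = M ** matrix_power M q"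
  by (simp_all add: matrix_power_def)

lemma matrix_power_Suc2: "matrix_power M (Suc q) = matrix_power M q ** M"
  by (induction q) (simp_all, metis matrix_mul_assoc)

lemma block_mult_assoc:
  "block_mult S X (block_mult S Y Z) i j = block_mult S (block_mult S X Y) Z i j"
  unfolding block_mult_def matrix_mult_sum_right matrix_mult_sum_left
  by (subst sum.swap) (simp add: matrix_mul_assoc)

text \<open>Uniqueness of inverses, Z = Z (X Y) = (Z X) Y = Y, relative to the index set. The
  witness \<open>Y\<close> also makes the choice in \<open>block_inv\<close> meaningful; blocks
  outside \<open>S\<close> remain arbitrary, hence the restriction on \<open>i\<close> and
  \<open>j\<close>.\<close>

lemma block_inv_eqI:
  assumes S: "finite S"
    and Y: "\<And>i j. i \<in> S \<Longrightarrow> j \<in> S \<Longrightarrow>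
      block_mult S X Y i j = block_id i j \<and> block_mult S Y X i j = block_id i j"
    and ij: "i \<in> S" "j \<in> S"
  shows "block_inv S X i j = Y i j"
proof -
  define Z where "Z = block_inv S X"
  have "\<exists>Y. \<forall>i\<in>S. \<forall>j\<in>S.
     block_mult S X Y i j = block_id i j \<and> block_mult S Y X i j = block_id i j"
    using Y by blast
  from someI_ex[OF this] have Z: "\<And>i j. i \<in> S \<Longrightarrow> j \<in> S \<Longrightarrow> block_mult S Z X i j = block_id i j"
    unfolding Z_def block_inv_def by blast
  have "block_mult S Z (block_mult S X Y) i j = Z i j"
  proof -
    have "block_mult S Z (block_mult S X Y) i j = (\<Sum>l\<in>S. if l = j then Z i l else 0)"
      unfolding block_mult_def[of S Z] using Y ij by (intro sum.cong) (auto simp: block_id_def)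
    then show ?thesis using S ij by simp
  qed
  moreover have "block_mult S (block_mult S Z X) Y i j = Y i j"
  proof -
    have "block_mult S (block_mult S Z X) Y i j = (\<Sum>l\<in>S. if i = l then Y l j else 0)"
      unfolding block_mult_def[of S _ Y] using Z ij by (intro sum.cong) (auto simp: block_id_def)
    then show ?thesis using S ij by simp
  qed
  ultimately show ?thesis using block_mult_assoc[of S Z X Y i j] by (simp add: Z_def)
qed

text \<open>The membership test on the neighbour is there because \<open>S\<close> may have gaps:
  among the F-points the predecessor can be a missing C-point.\<close>

lemma sum_bidiag_left:
  fixes Y :: "nat \<Rightarrow> complex^'n^'n"
  assumes "finite S" "i \<in> S"
  shows "(\<Sum>l\<in>S. bidiag M i l ** Y l) =
    Y i - (if i > 0 \<and> i - 1 \<in> S then M ** Y (i - 1) else 0)"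
proof -
  have "(\<Sum>l\<in>S. bidiag M i l ** Y l) =
      (\<Sum>l\<in>S. (if l = i then Y l else 0) - (if l = i - 1 then if i > 0 then M ** Y l else 0 else 0))"
    by (intro sum.cong) (auto simp: bidiag_def matrix_mult_minus_left)
  also have "\<dots> = Y i - (if i > 0 \<and> i - 1 \<in> S then M ** Y (i - 1) else 0)"
    using assms by (simp add: sum_subtractf)
  finally show ?thesis .
qed

lemma sum_bidiag_right:
  assumes "finite S" "j \<in> S"
  shows "(\<Sum>l\<in>S. Y l ** bidiag M l j) = Y j - (if Suc j \<in> S then Y (Suc j) ** M else 0)"
proof -
  have "(\<Sum>l\<in>S. Y l ** bidiag M l j) =
      (\<Sum>l\<in>S. (if l = j then Y l else 0) - (if l = Suc j then Y l ** M else 0))"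
    by (intro sum.cong) (auto simp: bidiag_def matrix_mult_minus_right)
  also have "\<dots> = Y j - (if Suc j \<in> S then Y (Suc j) ** M else 0)"
    using assms by (simp add: sum_subtractf)
  finally show ?thesis .
qed

text \<open>The finite Neumann series of identity minus a nilpotent block shift.\<close>

lemma block_inv_bidiag_coarse:
  assumes "i < n" "j < n"
  shows "block_inv {..<n} (bidiag M) i j = (if j \<le> i then matrix_power M (i - j) else 0)"
proof (rule block_inv_eqI)
  let ?Y = "\<lambda>i j. if j \<le> i then matrix_power M (i - j) else 0"
  fix i j assume ij: "i \<in> {..<n}" "j \<in> {..<n}"
  have "block_mult {..<n} (bidiag M) ?Y i j = block_id i j"
    unfolding block_mult_def using ij
    by (subst sum_bidiag_left, simp, simp, cases i)
       (auto simp: block_id_def Suc_diff_le)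
  moreover have "block_mult {..<n} ?Y (bidiag M) i j = block_id i j"
    unfolding block_mult_def using ij
    by (subst sum_bidiag_right)
       (auto simp: block_id_def matrix_power_Suc2[symmetric] Suc_diff_Suc simp del: matrix_power_Suc)
  ultimately show "block_mult {..<n} (bidiag M) ?Y i j = block_id i j \<and>
       block_mult {..<n} ?Y (bidiag M) i j = block_id i j" by blast
qed (use assms in auto)

lemma finite_F_points [simp]: "finite (F_points k Nc)"
  by (simp add: F_points_def)

text \<open>Between two C-points the F-points are consecutive, so stepping back from
  \<open>i\<close> towards an earlier F-point \<open>j\<close> of the same interval never meets a
  C-point.\<close>

lemma pred_mem_F_points_iff:
  assumes "k \<ge> 1" "i \<in> F_points k Nc" "j \<in> F_points k Nc" "i > 0"
  shows "i - 1 \<in> F_points k Nc \<and> j \<le> i - 1 \<and> (i - 1) div k = j div k \<longleftrightarrow> j < i \<and> i div k = j div k"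
proof -
  obtain i' where i: "i = Suc i'" using assms by (cases i) auto
  have "i' div k = i div k" using assms i by (auto simp: F_points_def div_Suc dvd_eq_mod_eq_0)
  moreover have "\<not> k dvd i'" if "j < i" "i div k = j div k"
  proof
    assume "k dvd i'"
    \<comment> \<open>A multiple of \<open>k\<close> is the least number with its quotient.\<close>
    then have "j \<ge> i'"
      using that \<open>i' div k = i div k\<close> by (metis dvd_div_mult_self div_times_less_eq_dividend)
    with that i have "j = i'" by simp
    then show False using assms \<open>k dvd i'\<close> by (auto simp: F_points_def)
  qed
  ultimately show ?thesis using assms i by (auto simp: F_points_def)
qed

text \<open>Removing the C-points cuts the bidiagonal matrix into independent bidiagonal pieces, one
  per coarse interval; each is inverted by its own Neumann series.\<close>

lemma block_inv_A_ff:
  assumes k: "k \<ge> 1" and "i \<in> F_points k Nc" "j \<in> F_points k Nc"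
  shows "block_inv (F_points k Nc) (A_ff \<Phi>) i j =
    (if j \<le> i \<and> i div k = j div k then matrix_power \<Phi> (i - j) else 0)"
proof (rule block_inv_eqI)
  let ?F = "F_points k Nc"
  let ?Y = "\<lambda>i j. if j \<le> i \<and> i div k = j div k then matrix_power \<Phi> (i - j) else 0"
  have A: "A_ff \<Phi> = bidiag \<Phi>" by (simp add: A_ff_def fun_eq_iff)
  fix i j assume ij: "i \<in> ?F" "j \<in> ?F"
  have "block_mult ?F (A_ff \<Phi>) ?Y i j =
      ?Y i j - (if i > 0 \<and> i - 1 \<in> ?F then \<Phi> ** ?Y (i - 1) j else 0)"
    unfolding block_mult_def A using ij by (subst sum_bidiag_left) auto
  also have "(if i > 0 \<and> i - 1 \<in> ?F then \<Phi> ** ?Y (i - 1) j else 0) =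
      (if j < i \<and> i div k = j div k then matrix_power \<Phi> (i - j) else 0)"
    using pred_mem_F_points_iff[OF k ij]
    by (auto simp flip: matrix_power_Suc simp: Suc_diff_Suc)
  also have "?Y i j - \<dots> = block_id i j"
    by (auto simp: block_id_def)
  finally have 1: "block_mult ?F (A_ff \<Phi>) ?Y i j = block_id i j" .
  have "block_mult ?F ?Y (A_ff \<Phi>) i j =
      ?Y i j - (if Suc j \<in> ?F then ?Y i (Suc j) ** \<Phi> else 0)"
    unfolding block_mult_def A using ij by (subst sum_bidiag_right) auto
  also have "(if Suc j \<in> ?F then ?Y i (Suc j) ** \<Phi> else 0) =
      (if j < i \<and> i div k = j div k then matrix_power \<Phi> (i - j) else 0)"
  proof -
    have "Suc j \<in> ?F \<and> Suc j \<le> i \<and> i div k = Suc j div k \<longleftrightarrow> j < i \<and> i div k = j div k"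
    proof
      assume "Suc j \<in> ?F \<and> Suc j \<le> i \<and> i div k = Suc j div k"
      then show "j < i \<and> i div k = j div k"
        by (auto simp: F_points_def div_Suc dvd_eq_mod_eq_0 split: if_splits)
    next
      assume a: "j < i \<and> i div k = j div k"
      have "\<not> k dvd Suc j"
      proof
        assume "k dvd Suc j"
        then have "Suc j div k = Suc (j div k)" by (simp add: div_Suc dvd_eq_mod_eq_0)
        moreover have "Suc j div k \<le> i div k" using a by (intro div_le_mono) auto
        ultimately show False using a by simp
      qed
      then show "Suc j \<in> ?F \<and> Suc j \<le> i \<and> i div k = Suc j div k"
        using a ij by (auto simp: F_points_def div_Suc dvd_eq_mod_eq_0)
    qed
    then show ?thesis
      by (auto simp flip: matrix_power_Suc2 simp: Suc_diff_Suc)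
  qed
  also have "?Y i j - \<dots> = block_id i j"
    by (auto simp: block_id_def)
  finally show "block_mult ?F (A_ff \<Phi>) ?Y i j = block_id i j \<and>
      block_mult ?F ?Y (A_ff \<Phi>) i j = block_id i j" using 1 by blast
qed (use assms in auto)

section \<open>The error propagator as a sweep over the C-points\<close>

lemma less_num_points_iff:
  assumes "k \<ge> 1" "Nc \<ge> 1"
  shows "i < num_points k Nc \<longleftrightarrow> i div k < Nc - 1 \<or> i = (Nc - 1) * k"
  using assms by (auto simp: num_points_def less_Suc_eq div_less_iff_less_mult)

lemma div_less_of_less_num_points:
  assumes "k \<ge> 1" "Nc \<ge> 1" "i < num_points k Nc"
  shows "i div k < Nc"
  using assms by (auto simp: less_num_points_iff)

text \<open>Only the first F-point after a C-point couples to it, so a column of \<open>A_fc\<close>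
  has a single block - \<Phi>, which the inverse then transports up to \<open>i\<close>.\<close>

lemma Aff_inv_Afc_eq:
  assumes k: "k \<ge> 1" and Nc: "Nc \<ge> 1" and i: "i \<in> F_points k Nc"
  shows "Aff_inv_Afc k Nc \<Phi> i b = - (if i div k = b then matrix_power \<Phi> (i mod k) else 0)"
proof -
  let ?F = "F_points k Nc"
  \<comment> \<open>For \<open>k = 1\<close> there are no F-points, so the existence of
    \<open>i\<close> excludes that case.\<close>
  have k2: "k \<ge> 2" using i k by (cases "k = 1") (auto simp: F_points_def)
  have "Aff_inv_Afc k Nc \<Phi> i b = (\<Sum>l\<in>?F. if l = Suc (b * k) then
      - ((if l \<le> i \<and> i div k = l div k then matrix_power \<Phi> (i - l) else 0) ** \<Phi>) else 0)"
    unfolding Aff_inv_Afc_def block_mult_def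
  proof (rule sum.cong)
    fix l assume l: "l \<in> ?F"
    then have "l \<noteq> b * k" by (auto simp: F_points_def)
    then have "A_fc k \<Phi> l b = (if l = Suc (b * k) then - \<Phi> else 0)"
      by (simp add: A_fc_def bidiag_def)
    then show "block_inv ?F (A_ff \<Phi>) i l ** A_fc k \<Phi> l b = (if l = Suc (b * k) then
        - ((if l \<le> i \<and> i div k = l div k then matrix_power \<Phi> (i - l) else 0) ** \<Phi>) else 0)"
      by (simp add: block_inv_A_ff[OF k i l] matrix_mult_minus_right)
  qed simp
  also have "\<dots> = (if Suc (b * k) \<in> ?F then - ((if Suc (b * k) \<le> i \<and> i div k = Suc (b * k) div k
      then matrix_power \<Phi> (i - Suc (b * k)) else 0) ** \<Phi>) else 0)"
    by (subst sum.delta) auto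
  also have "\<dots> = - (if i div k = b then matrix_power \<Phi> (i mod k) else 0)"
  proof -
    have d: "Suc (b * k) div k = b" using k2 by (simp add: div_Suc mod_Suc)
    have "Suc (b * k) \<in> ?F \<and> Suc (b * k) \<le> i" if "i div k = b"
    proof -
      have "i = b * k + i mod k" using that by (metis div_mult_mod_eq)
      moreover have "i mod k \<noteq> 0" using i by (auto simp: F_points_def dvd_eq_mod_eq_0)
      moreover have "\<not> k dvd Suc (b * k)" using k2 by (simp add: dvd_eq_mod_eq_0 mod_Suc)
      ultimately show ?thesis using i unfolding F_points_def by simp
    qed
    moreover have "i mod k = Suc (i - Suc (b * k))" if "i div k = b" "Suc (b * k) \<le> i"
    proof -
      have "i - b * k = i mod k" using that by (metis minus_div_mult_eq_mod)
      then show ?thesis using that by simp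
    qed
    ultimately show ?thesis
      by (auto simp: d matrix_power_Suc2 simp del: matrix_power_Suc)
  qed
  finally show ?thesis .
qed

text \<open>Each time point receives the fine propagation of the preceding C-value; C-points fit the
  same formula with exponent 0.\<close>

lemma ideal_interpolation_eq:
  assumes "k \<ge> 1" "Nc \<ge> 1" "i < num_points k Nc"
  shows "ideal_interpolation k Nc \<Phi> i a =
    (if i div k = a then matrix_power \<Phi> (i mod k) else 0)"
  using assms
  by (auto simp: ideal_interpolation_def block_id_def Aff_inv_Afc_eq F_points_def dvd_eq_mod_eq_0)

text \<open>Eliminating the F-points leaves exact time stepping over \<open>k\<close> fine steps.
  For \<open>k = 1\<close> the subdiagonal already sits in \<open>A_cc\<close>. For larger
  \<open>k\<close> C-points are not neighbours, \<open>A_cc\<close> is the identity, and the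
  subdiagonal comes from the last F-point of the preceding interval.\<close>

lemma A_Delta_eq:
  fixes \<Phi> :: "complex^'n::finite^'n"
  assumes k: "k \<ge> 1" and a: "a < Nc" and b: "b < Nc"
  shows "A_Delta k Nc \<Phi> a b = bidiag (matrix_power \<Phi> k) a b"
proof (cases "k = 1")
  case True
  then have "F_points k Nc = {}" by (auto simp: F_points_def)
  then show ?thesis using True by (simp add: A_Delta_def A_cc_def block_mult_def)
next
  case False
  let ?F = "F_points k Nc"
  have k2: "k \<ge> 2" using False k by simp
  have cc: "A_cc k \<Phi> a b = (if a = b then mat 1 else 0)"
  proof -
    have "a * k \<noteq> Suc (b * k)"
    proof
      assume "a * k = Suc (b * k)"
      then have "(a * k) mod k = Suc (b * k) mod k" by simp
      then show False using k2 by (simp add: mod_Suc)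
    qed
    then show ?thesis using k by (auto simp: A_cc_def bidiag_def)
  qed
  have "block_mult ?F (A_cf k \<Phi>) (Aff_inv_Afc k Nc \<Phi>) a b =
    (\<Sum>j\<in>?F. if j = a * k - 1 \<and> a \<ge> 1
       then \<Phi> ** (if j div k = b then matrix_power \<Phi> (j mod k) else 0) else 0)"
    unfolding block_mult_def
  proof (rule sum.cong)
    fix j assume j: "j \<in> ?F"
    then have "j \<noteq> a * k" by (auto simp: F_points_def)
    then have "A_cf k \<Phi> a j = (if j = a * k - 1 \<and> a \<ge> 1 then - \<Phi> else 0)"
      using k by (cases a) (auto simp: A_cf_def bidiag_def)
    moreover have "Aff_inv_Afc k Nc \<Phi> j b =
        - (if j div k = b then matrix_power \<Phi> (j mod k) else 0)"
      using a by (intro Aff_inv_Afc_eq[OF k _ j]) simp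
    ultimately show "A_cf k \<Phi> a j ** Aff_inv_Afc k Nc \<Phi> j b = (if j = a * k - 1 \<and> a \<ge> 1
       then \<Phi> ** (if j div k = b then matrix_power \<Phi> (j mod k) else 0) else 0)"
      by (simp add: matrix_mult_minus_right matrix_mult_minus_left)
  qed simp
  also have "\<dots> = (if a \<ge> 1 \<and> a * k - 1 \<in> ?F then
      \<Phi> ** (if (a * k - 1) div k = b then matrix_power \<Phi> ((a * k - 1) mod k) else 0) else 0)"
    by (cases "a \<ge> 1") simp_all
  also have "\<dots> = (if a = Suc b then matrix_power \<Phi> k else 0)"
  proof (cases a)
    case (Suc c)
    obtain k' where k': "k = Suc (Suc k')" using k2 by (metis add_2_eq_Suc le_Suc_ex)
    then have "Suc k' < k" by simp
    have e: "a * k - 1 = c * k + Suc k'" by (simp add: Suc k')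
    have "(a * k - 1) div k = c" "(a * k - 1) mod k = Suc k'"
      using \<open>Suc k' < k\<close> unfolding e by (simp_all del: add_Suc_right)
    moreover from this have "a * k - 1 \<in> ?F"
    proof -
      have "c * k + Suc k' < num_points k Nc"
      proof -
        have "a * k \<le> (Nc - 1) * k" using a by (intro mult_right_mono) auto
        then show ?thesis using e k2 Suc by (auto simp: num_points_def)
      qed
      moreover have "\<not> k dvd (a * k - 1)"
        using \<open>(a * k - 1) mod k = Suc k'\<close> by (simp add: dvd_eq_mod_eq_0)
      ultimately show ?thesis unfolding F_points_def e[symmetric] by blast
    qed
    ultimately show ?thesis using Suc by (auto simp: k')
  qed auto
  finally show ?thesis by (simp add: A_Delta_def cc bidiag_def)
qed

text \<open>The diagonal of the product is the identity and cancels, which leaves a strictly lower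
  triangular block Toeplitz matrix.\<close>

lemma coarse_propagator_eq:
  assumes k: "k \<ge> 1" and a: "a < Nc" and b: "b < Nc"
  shows "coarse_propagator k Nc \<Phi> \<Psi> a b =
    (if b < a then matrix_power \<Psi> (a - Suc b) ** (matrix_power \<Phi> k - \<Psi>) else 0)"
proof -
  let ?Y = "\<lambda>l. if l \<le> a then matrix_power \<Psi> (a - l) else 0"
  have "block_mult {..<Nc} (block_inv {..<Nc} (bidiag \<Psi>)) (A_Delta k Nc \<Phi>) a b =
      (\<Sum>l<Nc. ?Y l ** bidiag (matrix_power \<Phi> k) l b)"
    unfolding block_mult_def using assms
    by (intro sum.cong) (auto simp: block_inv_bidiag_coarse A_Delta_eq)
  also have "\<dots> = ?Y b - (if Suc b < Nc then ?Y (Suc b) ** matrix_power \<Phi> k else 0)"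
    using b by (subst sum_bidiag_right) auto
  finally show ?thesis
    using a by (auto simp: coarse_propagator_def block_id_def matrix_mult_diff_right
        Suc_diff_Suc simp flip: matrix_power_Suc2)
qed

text \<open>Parareal in its time-marching form, as an iteration of the errors at the C-points.\<close>

primrec coarse_sweep ::
  "complex^'n^'n \<Rightarrow> complex^'n^'n \<Rightarrow> 'n block_vector \<Rightarrow> nat \<Rightarrow> complex^'n::finite" where
  "coarse_sweep M \<Psi> c 0 = 0"
| "coarse_sweep M \<Psi> c (Suc a) = \<Psi> *v coarse_sweep M \<Psi> c a + (M - \<Psi>) *v c a"

text \<open>Discrete variation of constants: it identifies the matrix form of the coarse correction
  with the marching recursion.\<close>

lemma coarse_sweep_eq_sum:
  "coarse_sweep M \<Psi> c a = (\<Sum>b<a. (matrix_power \<Psi> (a - Suc b) ** (M - \<Psi>)) *v c b)"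
proof (induction a)
  case (Suc a)
  have "(\<Sum>b<a. (matrix_power \<Psi> (Suc a - Suc b) ** (M - \<Psi>)) *v c b) =
      \<Psi> *v (\<Sum>b<a. (matrix_power \<Psi> (a - Suc b) ** (M - \<Psi>)) *v c b)"
    unfolding matrix_vector_mult_sum
    by (intro sum.cong)
       (auto simp: matrix_vector_mul_assoc matrix_mul_assoc Suc_diff_Suc simp flip: matrix_power_Suc)
  then show ?case by (simp add: Suc)
qed simp

lemma coarse_sweep_cong:
  assumes "\<And>b. b < a \<Longrightarrow> c b = d b"
  shows "coarse_sweep M \<Psi> c a = coarse_sweep M \<Psi> d a"
  using assms by (induction a) auto

lemma E_F_eq:
  assumes k: "k \<ge> 1" and Nc: "Nc \<ge> 1" and i: "i < num_points k Nc"
  shows "E_F k Nc \<Phi> \<Psi> i j = matrix_power \<Phi> (i mod k) ** coarse_row k Nc \<Phi> \<Psi> (i div k) j"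
proof -
  have "E_F k Nc \<Phi> \<Psi> i j = (\<Sum>l<Nc. if i div k = l
      then matrix_power \<Phi> (i mod k) ** coarse_row k Nc \<Phi> \<Psi> l j else 0)"
    unfolding E_F_def block_mult_def
    using assms by (intro sum.cong) (auto simp: ideal_interpolation_eq)
  then show ?thesis using div_less_of_less_num_points[OF assms] by simp
qed

lemma block_apply_E_F:
  assumes k: "k \<ge> 1" and Nc: "Nc \<ge> 1" and i: "i < num_points k Nc"
  shows "block_apply {..<num_points k Nc} (E_F k Nc \<Phi> \<Psi>) v i =
    matrix_power \<Phi> (i mod k) *v coarse_sweep (matrix_power \<Phi> k) \<Psi> (\<lambda>b. v (b * k)) (i div k)"
proof -
  let ?N = "num_points k Nc" and ?a = "i div k"
  have a: "?a < Nc" by (rule div_less_of_less_num_points[OF assms])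
  \<comment> \<open>The columns of the block row at F-points vanish, so only the C-values of
    \<open>v\<close> enter.\<close>
  have "(\<Sum>j<?N. coarse_row k Nc \<Phi> \<Psi> ?a j *v v j) =
      (\<Sum>j\<in>(\<lambda>b. b * k) ` {..<Nc}. coarse_row k Nc \<Phi> \<Psi> ?a j *v v j)"
  proof (rule sum.mono_neutral_right)
    show "(\<lambda>b. b * k) ` {..<Nc} \<subseteq> {..<?N}"
      using Nc by (auto simp: num_points_def less_Suc_eq_le)
    show "\<forall>j\<in>{..<?N} - (\<lambda>b. b * k) ` {..<Nc}. coarse_row k Nc \<Phi> \<Psi> ?a j *v v j = 0"
      using div_less_of_less_num_points[OF k Nc] by (force simp: coarse_row_def)
  qed simp
  also have "\<dots> = (\<Sum>b<Nc. coarse_row k Nc \<Phi> \<Psi> ?a (b * k) *v v (b * k))"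
    using k by (subst sum.reindex) (auto simp: inj_on_def)
  also have "\<dots> = (\<Sum>b<?a. (matrix_power \<Psi> (?a - Suc b) ** (matrix_power \<Phi> k - \<Psi>)) *v v (b * k))"
    using a k by (intro sum.mono_neutral_cong_right) (auto simp: coarse_row_def coarse_propagator_eq)
  also have "\<dots> = coarse_sweep (matrix_power \<Phi> k) \<Psi> (\<lambda>b. v (b * k)) ?a"
    by (simp add: coarse_sweep_eq_sum)
  finally show ?thesis
    unfolding block_apply_def
    by (simp add: E_F_eq[OF assms] matrix_vector_mult_sum[symmetric] matrix_vector_mul_assoc[symmetric])
qed

text \<open>An iteration reads C-values only, so the recursion closes on them. The formula needs at
  least one iteration: the initial F-values are arbitrary and are discarded by it.\<close>

lemma error_after_Suc:
  assumes k: "k \<ge> 1" and Nc: "Nc \<ge> 1" and i: "i < num_points k Nc"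
  shows "error_after k Nc \<Phi> \<Psi> (Suc p) e0 i = matrix_power \<Phi> (i mod k) *v
    (coarse_sweep (matrix_power \<Phi> k) \<Psi> ^^ Suc p) (\<lambda>b. e0 (b * k)) (i div k)"
  using i
proof (induction p arbitrary: i)
  case 0
  then show ?case by (simp add: error_after_def block_apply_E_F[OF k Nc])
next
  case (Suc p)
  let ?S = "coarse_sweep (matrix_power \<Phi> k) \<Psi>" and ?c = "\<lambda>b. e0 (b * k)"
  have "error_after k Nc \<Phi> \<Psi> (Suc (Suc p)) e0 i = matrix_power \<Phi> (i mod k) *v
      ?S (\<lambda>b. error_after k Nc \<Phi> \<Psi> (Suc p) e0 (b * k)) (i div k)"
    using Suc.prems by (simp add: error_after_def block_apply_E_F[OF k Nc])
  also have "?S (\<lambda>b. error_after k Nc \<Phi> \<Psi> (Suc p) e0 (b * k)) (i div k) =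
      ?S ((?S ^^ Suc p) ?c) (i div k)"
  proof (rule coarse_sweep_cong)
    fix b assume "b < i div k"
    then have "b * k < num_points k Nc"
      using div_less_of_less_num_points[OF k Nc Suc.prems] k
      by (auto simp: less_num_points_iff[OF k Nc])
    from Suc.IH[OF this] show "error_after k Nc \<Phi> \<Psi> (Suc p) e0 (b * k) = (?S ^^ Suc p) ?c b"
      using k by simp
  qed
  finally show ?case by simp
qed

section \<open>Contraction of the scalar sweep\<close>

primrec scalar_sweep :: "complex \<Rightarrow> complex \<Rightarrow> (nat \<Rightarrow> complex) \<Rightarrow> nat \<Rightarrow> complex" where
  "scalar_sweep g \<mu> c 0 = 0"
| "scalar_sweep g \<mu> c (Suc a) = \<mu> * scalar_sweep g \<mu> c a + g * c a"

text \<open>The weight \<open>w\<close> of a C-point collects the F-points that follow it; the last C-point has none.\<close>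

definition weighted_sq :: "real \<Rightarrow> nat \<Rightarrow> (nat \<Rightarrow> complex) \<Rightarrow> real" where
  "weighted_sq w n c = w * (\<Sum>a<n. (cmod (c a))\<^sup>2) + (cmod (c n))\<^sup>2"

text \<open>Both squares on \<open>a\<close> and \<open>u * b\<close> contain the same cross term;
  eliminating it between them gives the identity.\<close>

lemma cmod_diff_scaled_sq:
  assumes "cmod u = 1"
  shows "(cmod (a - of_real m * u * b))\<^sup>2 =
    (1 - m) * (cmod a)\<^sup>2 - m * (1 - m) * (cmod b)\<^sup>2 + m * (cmod (a - u * b))\<^sup>2"
proof -
  have u: "(Re u)\<^sup>2 + (Im u)\<^sup>2 = 1" using assms by (simp flip: cmod_power2)
  have ub: "(cmod (u * b))\<^sup>2 = (cmod b)\<^sup>2" using assms by (simp add: norm_mult)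
  have "(cmod (a - of_real m * v))\<^sup>2 =
      (1 - m) * (cmod a)\<^sup>2 - m * (1 - m) * (cmod v)\<^sup>2 + m * (cmod (a - v))\<^sup>2" for v
    unfolding cmod_power2 by (simp add: power2_eq_square algebra_simps)
  from this[of "u * b"] show ?thesis by (simp add: ub mult.assoc)
qed

text \<open>As \<open>y 0 = 0\<close>, the sum of |y_a|^2 is that of |y_(a+1)|^2 minus |y_n|^2, and
  (1-m) - m(1-m) = (1-m)^2. The difference of the two sums is the boundary term.\<close>

lemma sum_diff_scaled_sq:
  assumes "cmod u = 1" "y 0 = 0"
  shows "(\<Sum>a<n. (cmod (y (Suc a) - of_real m * u * y a))\<^sup>2) =
    (1 - m)\<^sup>2 * (\<Sum>a<n. (cmod (y (Suc a)))\<^sup>2) + m * (1 - m) * (cmod (y n))\<^sup>2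
    + m * (\<Sum>a<n. (cmod (y (Suc a) - u * y a))\<^sup>2)"
proof (induction n)
  case (Suc n)
  then show ?case
    by (simp only: sum.lessThan_Suc Suc cmod_diff_scaled_sq[OF assms(1)])
       (simp add: algebra_simps power2_eq_square)
qed (simp add: assms)

text \<open>Since |u| = 1, the modulus of \<open>y\<close> grows from 0 by at most one twisted
  increment per step; Cauchy-Schwarz turns the sum of increments into the sum of their
  squares.\<close>

lemma discrete_Poincare:
  assumes u: "cmod u = 1" and y: "y 0 = 0"
  shows "(\<Sum>a<n. (cmod (y (Suc a)))\<^sup>2) \<le> (real n)\<^sup>2 * (\<Sum>a<n. (cmod (y (Suc a) - u * y a))\<^sup>2)"
proof -
  define d where "d a = cmod (y (Suc a) - u * y a)" for a
  have y_le: "cmod (y a) \<le> (\<Sum>b<a. d b)" for a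
  proof (induction a)
    case (Suc a)
    have "cmod (y (Suc a)) \<le> d a + cmod (u * y a)"
      unfolding d_def by (metis diff_add_cancel norm_triangle_ineq)
    then show ?case using Suc u by (simp add: norm_mult)
  qed (simp add: y)
  have "(cmod (y (Suc a)))\<^sup>2 \<le> real n * (\<Sum>b<n. (d b)\<^sup>2)" if "a < n" for a
  proof -
    have "(\<Sum>b<Suc a. d b) \<le> (\<Sum>b<n. d b)"
      using that by (intro sum_mono2) (auto simp: d_def)
    then have "cmod (y (Suc a)) \<le> (\<Sum>b<n. d b)" using y_le[of "Suc a"] by linarith
    then have "(cmod (y (Suc a)))\<^sup>2 \<le> (\<Sum>b<n. d b)\<^sup>2" by (intro power_mono) auto
    also have "\<dots> \<le> real (card {..<n}) * (\<Sum>b<n. (d b)\<^sup>2)"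
      using Cauchy_Schwarz_ineq_sum[of "\<lambda>_. 1" d "{..<n}"] by simp
    finally show ?thesis by simp
  qed
  then have "(\<Sum>a<n. (cmod (y (Suc a)))\<^sup>2) \<le> (\<Sum>a<n. real n * (\<Sum>b<n. (d b)\<^sup>2))"
    by (intro sum_mono) auto
  then show ?thesis by (simp add: d_def power2_eq_square mult.assoc)
qed

lemma polar_unit: "\<exists>u. cmod u = 1 \<and> z = of_real (cmod z) * u"
proof (cases "z = 0")
  case True
  then show ?thesis by (intro exI[of _ 1]) simp
next
  case False
  then show ?thesis by (intro exI[of _ "sgn z"]) (simp add: sgn_eq norm_divide)
qed

text \<open>The nonnegative boundary term is dropped. The separate bound \<open>M\<close> avoids
  division by 0 for \<open>n = 0\<close> and lets the gain be expressed in the number of C-points,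
  one more than the number of increments.\<close>

lemma sum_diff_scaled_sq_ge:
  assumes y: "y 0 = 0" and \<mu>: "cmod \<mu> < 1" and n: "n \<le> M" "M \<ge> 1"
  shows "((1 - cmod \<mu>)\<^sup>2 + cmod \<mu> / (real M)\<^sup>2) * (\<Sum>a<n. (cmod (y (Suc a)))\<^sup>2)
    \<le> (\<Sum>a<n. (cmod (y (Suc a) - \<mu> * y a))\<^sup>2)"
proof -
  obtain u where u: "cmod u = 1" "\<mu> = of_real (cmod \<mu>) * u" using polar_unit by blast
  let ?m = "cmod \<mu>" and ?Y = "\<Sum>a<n. (cmod (y (Suc a)))\<^sup>2"
    and ?D = "\<Sum>a<n. (cmod (y (Suc a) - u * y a))\<^sup>2"
  have "?Y \<le> (real n)\<^sup>2 * ?D" by (rule discrete_Poincare[where y = y, OF u(1) y])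
  also have "\<dots> \<le> (real M)\<^sup>2 * ?D" using n by (intro mult_right_mono power_mono sum_nonneg) auto
  finally have "?Y / (real M)\<^sup>2 \<le> ?D" using n by (simp add: divide_le_eq mult.commute)
  then have "?m * (?Y / (real M)\<^sup>2) \<le> ?m * ?D" by (intro mult_left_mono) auto
  moreover have "0 \<le> ?m * (1 - ?m) * (cmod (y n))\<^sup>2" using \<mu> by simp
  moreover have "(\<Sum>a<n. (cmod (y (Suc a) - \<mu> * y a))\<^sup>2) =
      (1 - ?m)\<^sup>2 * ?Y + ?m * (1 - ?m) * (cmod (y n))\<^sup>2 + ?m * ?D"
    using sum_diff_scaled_sq[where m = "?m" and y = y, OF u(1) y] u(2) by simp
  ultimately show ?thesis by (simp add: distrib_right)
qed

text \<open>The last block never influences an earlier one, so its smaller weight does no harm.\<close>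

lemma weighted_sq_sweep_le:
  assumes w: "w \<ge> 1" and \<mu>: "cmod \<mu> < 1" and \<phi>: "cmod g \<le> \<phi> * (1 - cmod \<mu>)"
    and n: "n \<le> M" "M \<ge> 1" and \<kappa>: "0 \<le> \<kappa>" "\<kappa> \<le> cmod \<mu>"
  shows "weighted_sq w n (scalar_sweep g \<mu> c)
    \<le> \<phi>\<^sup>2 * (1 - \<kappa> / (real M)\<^sup>2) * (w * (\<Sum>a<n. (cmod (c a))\<^sup>2))"
proof -
  let ?y = "scalar_sweep g \<mu> c" and ?m = "cmod \<mu>"
  let ?Y = "\<Sum>a<n. (cmod (?y (Suc a)))\<^sup>2" and ?C = "\<Sum>a<n. (cmod (c a))\<^sup>2"
  let ?b = "(1 - ?m)\<^sup>2 + ?m / (real M)\<^sup>2" and ?r = "1 - \<kappa> / (real M)\<^sup>2"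
  have M: "1 \<le> (real M)\<^sup>2" using n by simp
  have \<kappa>M: "\<kappa> / (real M)\<^sup>2 \<le> ?m / (real M)\<^sup>2" using \<kappa> by (intro divide_right_mono) auto
  have mM: "?m / (real M)\<^sup>2 \<le> ?m"
    using divide_left_mono[OF M, of ?m] n by simp
  have b0: "?b > 0" using \<mu> by (intro add_pos_nonneg) auto
  have r0: "0 \<le> ?r" using \<kappa>M mM \<mu> by linarith
  \<comment> \<open>Trades the additive gain in \<open>?b\<close> for a factor: as \<open>?b\<close>
    \<le> 1, the loss \<open>\<kappa> / (real M)\<^sup>2 * ?b\<close> is at most the summand
    \<open>?m / (real M)\<^sup>2\<close> by which \<open>?b\<close> exceeds
    \<open>(1 - ?m)\<^sup>2\<close>.\<close>
  have b1: "(1 - ?m)\<^sup>2 \<le> ?r * ?b"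
  proof -
    have "?b \<le> (1 - ?m)\<^sup>2 + ?m" using mM by simp
    also have "\<dots> = 1 - ?m * (1 - ?m)" by (simp add: power2_eq_square algebra_simps)
    also have "\<dots> \<le> 1" using \<mu> by simp
    finally have "\<kappa> / (real M)\<^sup>2 * ?b \<le> \<kappa> / (real M)\<^sup>2 * 1" using \<kappa> by (intro mult_left_mono) auto
    then show ?thesis using \<kappa>M by (simp add: left_diff_distrib)
  qed
  have "?b * ?Y \<le> (\<Sum>a<n. (cmod (?y (Suc a) - \<mu> * ?y a))\<^sup>2)"
    by (rule sum_diff_scaled_sq_ge[OF _ \<mu> n]) simp
  also have "\<dots> = (cmod g)\<^sup>2 * ?C"
    by (simp add: norm_mult power_mult_distrib sum_distrib_left)
  also have "\<dots> \<le> (\<phi> * (1 - ?m))\<^sup>2 * ?C"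
    using \<phi> by (intro mult_right_mono power_mono sum_nonneg) auto
  also have "\<dots> = \<phi>\<^sup>2 * (1 - ?m)\<^sup>2 * ?C" by (simp add: power_mult_distrib)
  also have "\<dots> \<le> \<phi>\<^sup>2 * (?r * ?b) * ?C"
    using b1 by (intro mult_right_mono mult_left_mono sum_nonneg) auto
  finally have "?b * ?Y \<le> ?b * (\<phi>\<^sup>2 * ?r * ?C)" by (simp only: mult_ac)
  then have Y: "?Y \<le> \<phi>\<^sup>2 * ?r * ?C" using b0 by (simp only: mult_le_cancel_left_pos)
  have "weighted_sq w n ?y \<le> w * ((\<Sum>a<n. (cmod (?y a))\<^sup>2) + (cmod (?y n))\<^sup>2)"
    unfolding weighted_sq_def distrib_left
    using mult_right_mono[OF w, of "(cmod (?y n))\<^sup>2"] by simp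
  also have "(\<Sum>a<n. (cmod (?y a))\<^sup>2) + (cmod (?y n))\<^sup>2 = ?Y"
    using sum.lessThan_Suc_shift[of "\<lambda>a. (cmod (?y a))\<^sup>2" n] by simp
  also have "w * ?Y \<le> w * (\<phi>\<^sup>2 * ?r * ?C)" using Y w by (intro mult_left_mono) auto
  finally show ?thesis by (simp only: mult_ac)
qed

lemma weighted_sq_nonneg: "w \<ge> 0 \<Longrightarrow> weighted_sq w n c \<ge> 0"
  by (simp add: weighted_sq_def sum_nonneg)

section \<open>Almost extremal sequences\<close>

definition scalar_unsweep :: "complex \<Rightarrow> complex \<Rightarrow> (nat \<Rightarrow> complex) \<Rightarrow> nat \<Rightarrow> complex" where
  "scalar_unsweep g \<mu> y a = (y (Suc a) - \<mu> * y a) / g"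

definition sum_sq :: "nat \<Rightarrow> (nat \<Rightarrow> complex) \<Rightarrow> real" where
  "sum_sq n c = (\<Sum>a<n. (cmod (c a))\<^sup>2)"

text \<open>The increment of \<open>y\<close> once the phase \<open>u ^ a\<close> is removed; its
  \<open>sum_sq\<close> is a discrete Dirichlet energy.\<close>

definition twisted_diff :: "complex \<Rightarrow> (nat \<Rightarrow> complex) \<Rightarrow> nat \<Rightarrow> complex" where
  "twisted_diff u y a = y (Suc a) - u * y a"

lemma sum_sq_nonneg: "0 \<le> sum_sq n c"
  by (simp add: sum_sq_def sum_nonneg)

lemma sum_sq_shift:
  assumes "c n = 0"
  shows "sum_sq n (\<lambda>a. c (Suc a)) = sum_sq n c - (cmod (c 0))\<^sup>2"
proof -
  have "sum_sq n c = sum_sq (Suc n) c" using assms by (simp add: sum_sq_def)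
  also have "\<dots> = (cmod (c 0))\<^sup>2 + sum_sq n (\<lambda>a. c (Suc a))"
    unfolding sum_sq_def by (rule sum.lessThan_Suc_shift)
  finally show ?thesis by simp
qed

lemma sweep_unsweep:
  assumes "g \<noteq> 0" "y 0 = 0"
  shows "scalar_sweep g \<mu> (scalar_unsweep g \<mu> y) = y"
proof
  fix a
  show "scalar_sweep g \<mu> (scalar_unsweep g \<mu> y) a = y a"
    using assms by (induction a) (simp_all add: scalar_unsweep_def)
qed

text \<open>The completed square without boundary term. A backward step thus multiplies the sum of
  squares by (1-m)^2 / |g|^2, up to the Dirichlet energy.\<close>

lemma unsweep_sum_sq:
  assumes u: "cmod u = 1" "\<mu> = of_real (cmod \<mu>) * u" and g: "g \<noteq> 0"
    and y: "y 0 = 0" "y n = 0"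
  shows "(cmod g)\<^sup>2 * sum_sq n (scalar_unsweep g \<mu> y) =
    (1 - cmod \<mu>)\<^sup>2 * sum_sq n y + cmod \<mu> * sum_sq n (twisted_diff u y)"
proof -
  have "(cmod g)\<^sup>2 * sum_sq n (scalar_unsweep g \<mu> y) =
      (\<Sum>a<n. (cmod (y (Suc a) - of_real (cmod \<mu>) * u * y a))\<^sup>2)"
    using g u(2) by (simp add: sum_sq_def scalar_unsweep_def sum_distrib_left norm_divide power_divide)
  then show ?thesis
    using sum_sq_shift[of y n] y
    by (simp add: sum_diff_scaled_sq[where y = y, OF u(1) y(1)] sum_sq_def twisted_diff_def)
qed

lemma norm_diff_sq_le: "(norm (a - b))\<^sup>2 \<le> 2 * (norm a)\<^sup>2 + 2 * (norm b)\<^sup>2"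
proof -
  have "(norm (a - b))\<^sup>2 \<le> (norm a + norm b)\<^sup>2" by (intro power_mono norm_triangle_ineq4) auto
  also have "\<dots> \<le> 2 * (norm a)\<^sup>2 + 2 * (norm b)\<^sup>2"
    using zero_le_power2[of "norm a - norm b"] by (simp add: power2_eq_square algebra_simps)
  finally show ?thesis .
qed

text \<open>Both operations are constant-coefficient difference operators and commute, so the left
  side is a backward step applied to the twisted difference. Two consecutive zeros of
  \<open>y\<close> make that difference vanish at \<open>n\<close>, so the index shift brings in no
  new term.\<close>

lemma unsweep_twisted_diff:
  assumes \<mu>: "cmod \<mu> < 1" and g: "g \<noteq> 0" and y: "y n = 0" "y (Suc n) = 0"
  shows "(cmod g)\<^sup>2 * sum_sq n (twisted_diff u (scalar_unsweep g \<mu> y))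
    \<le> 4 * sum_sq n (twisted_diff u y)"
proof -
  let ?d = "twisted_diff u y"
  have le: "(cmod (?d (Suc a) - \<mu> * ?d a))\<^sup>2 \<le> 2 * (cmod (?d (Suc a)))\<^sup>2 + 2 * (cmod (?d a))\<^sup>2" for a
  proof -
    have "(cmod (\<mu> * ?d a))\<^sup>2 \<le> (cmod (?d a))\<^sup>2"
      using \<mu> by (intro power_mono) (auto simp: norm_mult mult_left_le_one_le)
    with norm_diff_sq_le[of "?d (Suc a)" "\<mu> * ?d a"] show ?thesis by linarith
  qed
  have "(cmod g)\<^sup>2 * sum_sq n (twisted_diff u (scalar_unsweep g \<mu> y)) =
      (\<Sum>a<n. (cmod (?d (Suc a) - \<mu> * ?d a))\<^sup>2)"
    unfolding sum_sq_def sum_distrib_left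
  proof (rule sum.cong)
    fix a
    have "?d (Suc a) - \<mu> * ?d a = g * twisted_diff u (scalar_unsweep g \<mu> y) a"
      using g by (simp add: twisted_diff_def scalar_unsweep_def field_simps)
    then show "(cmod g)\<^sup>2 * (cmod (twisted_diff u (scalar_unsweep g \<mu> y) a))\<^sup>2 =
        (cmod (?d (Suc a) - \<mu> * ?d a))\<^sup>2"
      by (simp add: norm_mult power_mult_distrib)
  qed simp
  also have "\<dots> \<le> (\<Sum>a<n. 2 * (cmod (?d (Suc a)))\<^sup>2 + 2 * (cmod (?d a))\<^sup>2)"
    by (intro sum_mono le)
  also have "\<dots> = 2 * sum_sq n (\<lambda>a. ?d (Suc a)) + 2 * sum_sq n ?d"
    by (simp add: sum_sq_def sum.distrib sum_distrib_left)
  also have "sum_sq n (\<lambda>a. ?d (Suc a)) \<le> sum_sq n ?d"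
    using y by (subst sum_sq_shift) (auto simp: twisted_diff_def)
  finally show ?thesis by simp
qed

text \<open>Each backward step looks one index ahead and so uses up one leading zero. The energy may
  grow by 4 / |g|^2 per step and feeds into the sum of squares, whence the crude total
  \<open>real q * 4 ^ q\<close>. Powers of |g|^2 are kept on the left to avoid division. The lower
  bound serves to keep the result nonzero.\<close>

lemma iterated_unsweep:
  assumes u: "cmod u = 1" "\<mu> = of_real (cmod \<mu>) * u" and \<mu>: "cmod \<mu> < 1" and g: "g \<noteq> 0"
    and y: "\<And>a. a \<le> p \<Longrightarrow> y a = 0" "\<And>a. a \<ge> n \<Longrightarrow> y a = 0"
    and "q \<le> p"
  defines "z \<equiv> \<lambda>q. (scalar_unsweep g \<mu> ^^ q) y"
  shows "(\<forall>a. a + q \<le> p \<longrightarrow> z q a = 0) \<and> (\<forall>a\<ge>n. z q a = 0) \<and>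
    (scalar_sweep g \<mu> ^^ q) (z q) = y \<and>
    (cmod g ^ 2) ^ q * sum_sq n (twisted_diff u (z q)) \<le> 4 ^ q * sum_sq n (twisted_diff u y) \<and>
    ((1 - cmod \<mu>)\<^sup>2) ^ q * sum_sq n y \<le> (cmod g ^ 2) ^ q * sum_sq n (z q) \<and>
    (cmod g ^ 2) ^ q * sum_sq n (z q)
      \<le> ((1 - cmod \<mu>)\<^sup>2) ^ q * sum_sq n y + real q * 4 ^ q * sum_sq n (twisted_diff u y)"
  using \<open>q \<le> p\<close>
proof (induction q)
  case 0
  then show ?case using y by (simp add: z_def)
next
  case (Suc q)
  let ?\<gamma> = "(cmod g)\<^sup>2" and ?\<beta> = "(1 - cmod \<mu>)\<^sup>2" and ?m = "cmod \<mu>"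
  let ?Y = "sum_sq n y" and ?D = "sum_sq n (twisted_diff u y)"
  let ?Z = "sum_sq n (z q)" and ?E = "sum_sq n (twisted_diff u (z q))"
  have zS: "z (Suc q) = scalar_unsweep g \<mu> (z q)" by (simp add: z_def)
  have IH: "\<And>a. a + q \<le> p \<Longrightarrow> z q a = 0" "\<And>a. a \<ge> n \<Longrightarrow> z q a = 0"
      "(scalar_sweep g \<mu> ^^ q) (z q) = y" "?\<gamma> ^ q * ?E \<le> 4 ^ q * ?D" "?\<beta> ^ q * ?Y \<le> ?\<gamma> ^ q * ?Z"
      "?\<gamma> ^ q * ?Z \<le> ?\<beta> ^ q * ?Y + real q * 4 ^ q * ?D"
    using Suc by auto
  have z0: "z q 0 = 0" using IH(1) Suc.prems by simp
  have \<beta>: "0 \<le> ?\<beta>" "?\<beta> \<le> 1" using \<mu> by (auto intro: power_le_one)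
  have D: "0 \<le> ?D" "0 \<le> ?E" by (auto intro: sum_sq_nonneg)
  have eq: "?\<gamma> * sum_sq n (z (Suc q)) = ?\<beta> * ?Z + ?m * ?E"
    unfolding zS by (rule unsweep_sum_sq[where y = "z q", OF u g z0]) (simp add: IH)
  have diff: "?\<gamma> * sum_sq n (twisted_diff u (z (Suc q))) \<le> 4 * ?E"
    unfolding zS by (rule unsweep_twisted_diff[OF \<mu> g]) (simp_all add: IH)
  have 1: "(\<forall>a. a + Suc q \<le> p \<longrightarrow> z (Suc q) a = 0) \<and> (\<forall>a\<ge>n. z (Suc q) a = 0)"
    using IH(1,2) by (auto simp: zS scalar_unsweep_def)
  have 2: "(scalar_sweep g \<mu> ^^ Suc q) (z (Suc q)) = y"
    using IH(3) sweep_unsweep[where y = "z q", OF g z0] by (simp add: zS funpow_swap1)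
  have 3: "?\<gamma> ^ Suc q * sum_sq n (twisted_diff u (z (Suc q))) \<le> 4 ^ Suc q * ?D"
  proof -
    have "?\<gamma> ^ q * (?\<gamma> * sum_sq n (twisted_diff u (z (Suc q)))) \<le> ?\<gamma> ^ q * (4 * ?E)"
      using diff by (intro mult_left_mono) auto
    also have "\<dots> \<le> 4 * (4 ^ q * ?D)" using IH(4) by simp
    finally show ?thesis by (simp add: mult_ac)
  qed
  have expand: "?\<gamma> ^ Suc q * sum_sq n (z (Suc q)) = ?\<beta> * (?\<gamma> ^ q * ?Z) + ?m * (?\<gamma> ^ q * ?E)"
  proof -
    have "?\<gamma> ^ Suc q * sum_sq n (z (Suc q)) = ?\<gamma> ^ q * (?\<gamma> * sum_sq n (z (Suc q)))"
      by (simp only: power_Suc mult_ac)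
    also have "\<dots> = ?\<gamma> ^ q * (?\<beta> * ?Z + ?m * ?E)" by (simp only: eq)
    finally show ?thesis by (simp add: algebra_simps)
  qed
  have 4: "?\<beta> ^ Suc q * ?Y \<le> ?\<gamma> ^ Suc q * sum_sq n (z (Suc q))"
  proof -
    have "?\<beta> * (?\<beta> ^ q * ?Y) \<le> ?\<beta> * (?\<gamma> ^ q * ?Z)" using IH(5) by (intro mult_left_mono) auto
    moreover have "0 \<le> ?m * (?\<gamma> ^ q * ?E)" using D by simp
    ultimately show ?thesis unfolding expand by simp
  qed
  have 5: "?\<gamma> ^ Suc q * sum_sq n (z (Suc q)) \<le> ?\<beta> ^ Suc q * ?Y + real (Suc q) * 4 ^ Suc q * ?D"
  proof -
    have "?\<beta> * (?\<gamma> ^ q * ?Z) \<le> ?\<beta> * (?\<beta> ^ q * ?Y + real q * 4 ^ q * ?D)"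
      using IH(6) by (intro mult_left_mono) auto
    moreover have "?\<beta> * (real q * 4 ^ q * ?D) \<le> 1 * (real q * 4 ^ q * ?D)"
      using \<beta> D by (intro mult_right_mono) auto
    moreover have "?m * (?\<gamma> ^ q * ?E) \<le> 1 * (4 ^ q * ?D)"
      using \<mu> D by (intro mult_mono[OF _ IH(4)]) auto
    ultimately have "?\<gamma> ^ Suc q * sum_sq n (z (Suc q)) \<le>
        ?\<beta> ^ Suc q * ?Y + (real q + 1) * (4 ^ q * ?D)"
      unfolding expand by (simp add: algebra_simps)
    also have "(real q + 1) * (4 ^ q * ?D) \<le> real (Suc q) * 4 ^ Suc q * ?D"
    proof -
      have "0 \<le> (real q + 1) * (4 ^ q * ?D)" using D by simp
      then show ?thesis by (simp add: algebra_simps)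
    qed
    finally show ?thesis by simp
  qed
  show ?case using 1 2 3 4 5 by blast
qed

text \<open>A triangular bump, twisted by the phase of the symbol's maximum, is an approximate
  extremal vector of the truncated Toeplitz operator.\<close>

lemma exists_bump:
  assumes u: "cmod u = 1" and n: "n \<ge> 6" "n \<ge> 2 * p"
  shows "\<exists>y. (\<forall>a\<le>p. y a = 0) \<and> (\<forall>a\<ge>n. y a = 0) \<and> sum_sq n y > 0 \<and>
    sum_sq n (twisted_diff u y) \<le> 1728 / (real n)\<^sup>2 * sum_sq n y"
proof -
  \<comment> \<open>Truncated subtraction makes the tent vanish for \<open>a\<close> \<le>
    \<open>p\<close> as well as for \<open>a\<close> \<ge> \<open>n\<close>.\<close>
  define b where "b a = real (min (a - p) (n - a))" for a
  define y where "y a = u ^ a * complex_of_real (b a)" for a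
  \<comment> \<open>On the \<open>q\<close> points from \<open>p + q\<close> on, the tent has height
    at least \<open>q\<close>, since \<open>p\<close> \<le> \<open>n\<close> / 2 leaves room for
    three such stretches. The constant 1728 is the cube of 12, from \<open>n\<close> \<le>
    \<open>12 * q\<close>.\<close>
  define q where "q = n div 6"
  have q: "q \<ge> 1" "p + 3 * q \<le> n" "n \<le> 12 * q" using n unfolding q_def by presburger+
  have "(cmod (twisted_diff u y a))\<^sup>2 \<le> 1" for a
  proof -
    have "twisted_diff u y a = u ^ Suc a * complex_of_real (b (Suc a) - b a)"
      by (simp add: twisted_diff_def y_def algebra_simps)
    then have "cmod (twisted_diff u y a) = \<bar>b (Suc a) - b a\<bar>"
      by (simp only: norm_mult norm_power u norm_of_real) simp
    also have "\<dots> \<le> 1" unfolding b_def by (auto simp: min_def of_nat_diff)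
    finally show ?thesis by (simp add: power_le_one)
  qed
  then have "sum_sq n (twisted_diff u y) \<le> (\<Sum>a<n. 1)"
    unfolding sum_sq_def by (intro sum_mono)
  then have D: "sum_sq n (twisted_diff u y) \<le> real n" by simp
  have "(\<Sum>a\<in>{p+q..<p+2*q}. (real q)\<^sup>2) \<le> (\<Sum>a\<in>{p+q..<p+2*q}. (cmod (y a))\<^sup>2)"
  proof (intro sum_mono power_mono)
    fix a assume "a \<in> {p+q..<p+2*q}"
    then have "q \<le> min (a - p) (n - a)" using q by auto
    then show "real q \<le> cmod (y a)" by (simp add: y_def b_def norm_mult norm_power u)
  qed simp
  also have "\<dots> \<le> sum_sq n y"
    unfolding sum_sq_def using q by (intro sum_mono2) auto
  finally have Y: "(real q) ^ 3 \<le> sum_sq n y" by (simp add: power3_eq_cube power2_eq_square)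
  have "(real n) ^ 3 \<le> (12 * real q) ^ 3" using q by (intro power_mono) auto
  also have "\<dots> \<le> 1728 * sum_sq n y" using Y by (simp add: power_mult_distrib)
  finally have "real n * (real n)\<^sup>2 \<le> 1728 * sum_sq n y" by (simp add: power3_eq_cube power2_eq_square)
  then have "real n \<le> 1728 / (real n)\<^sup>2 * sum_sq n y" using n by (simp add: pos_le_divide_eq)
  moreover have "0 < sum_sq n y" using Y q by (auto intro: less_le_trans[of _ "real q ^ 3"])
  ultimately show ?thesis
    using D by (intro exI[of _ y]) (auto simp: y_def b_def)
qed

text \<open>The witness is the bump pulled back by \<open>p\<close> sweeps. Its zero at 0 permits
  one more pull-back, and the zeros from \<open>n\<close> on make the weight of the last C-point
  irrelevant.\<close>

lemma exists_slow_sequence: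
  assumes \<mu>: "cmod \<mu> < 1" and g: "g \<noteq> 0"
  defines "\<phi> \<equiv> cmod g / (1 - cmod \<mu>)"
  shows "\<exists>C\<ge>0. \<forall>n\<ge>6 + 2 * p. \<exists>c. c 0 = 0 \<and> (\<forall>a\<ge>n. c a = 0) \<and>
    (\<forall>a\<ge>n. (scalar_sweep g \<mu> ^^ p) c a = 0) \<and> sum_sq n c > 0 \<and>
    (\<phi> ^ (2 * p) - C / (real n)\<^sup>2) * sum_sq n c \<le> sum_sq n ((scalar_sweep g \<mu> ^^ p) c)"
proof -
  obtain u where u: "cmod u = 1" "\<mu> = of_real (cmod \<mu>) * u" using polar_unit by blast
  define B where "B = ((1 - cmod \<mu>)\<^sup>2) ^ p"
  define G where "G = ((cmod g)\<^sup>2) ^ p"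
  \<comment> \<open>Accumulated backward error \<open>p * 4 ^ p\<close> times the energy constant of
    the bump.\<close>
  define K where "K = real p * 4 ^ p * 1728"
  have B: "B > 0" and G: "G > 0" and K: "K \<ge> 0" using \<mu> g by (auto simp: B_def G_def K_def)
  have \<phi>: "\<phi> ^ (2 * p) = G / B" by (simp add: \<phi>_def G_def B_def power_divide power_mult)
  show ?thesis
  proof (intro exI[of _ "G * K / B\<^sup>2"] conjI allI impI)
    show "0 \<le> G * K / B\<^sup>2" using G K by simp
    fix n assume n: "n \<ge> 6 + 2 * p"
    obtain y where y: "\<And>a. a \<le> p \<Longrightarrow> y a = 0" "\<And>a. a \<ge> n \<Longrightarrow> y a = 0" "sum_sq n y > 0"
        "sum_sq n (twisted_diff u y) \<le> 1728 / (real n)\<^sup>2 * sum_sq n y"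
      using exists_bump[OF u(1), of n p] n by auto
    define c where "c = (scalar_unsweep g \<mu> ^^ p) y"
    note * = iterated_unsweep[of u \<mu> g p y n p, OF u \<mu> g y(1) y(2) order_refl, folded c_def B_def G_def]
    have c: "c 0 = 0" "\<forall>a\<ge>n. c a = 0" "(scalar_sweep g \<mu> ^^ p) c = y"
        "B * sum_sq n y \<le> G * sum_sq n c"
        "G * sum_sq n c \<le> B * sum_sq n y + real p * 4 ^ p * sum_sq n (twisted_diff u y)"
      using * by auto
    have "0 < G * sum_sq n c" using c(4) B y(3) by (meson less_le_trans mult_pos_pos)
    then have cpos: "0 < sum_sq n c" using G by (simp add: zero_less_mult_iff)
    define t where "t = K / (real n)\<^sup>2"
    have t: "t \<ge> 0" using K by (simp add: t_def)
    have "real p * 4 ^ p * sum_sq n (twisted_diff u y)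
        \<le> real p * 4 ^ p * (1728 / (real n)\<^sup>2 * sum_sq n y)"
      using y(4) by (intro mult_left_mono) auto
    also have "\<dots> = t * sum_sq n y" by (simp add: t_def K_def)
    finally have up: "G * sum_sq n c \<le> (B + t) * sum_sq n y" using c(5) by (simp add: distrib_right)
    \<comment> \<open>1/B - t/B^2 is the tangent at 0 of the convex function 1/(B+t), so multiplying
      it by B + t gives at most 1. The case split is needed because the upper estimate may be
      multiplied only by a nonnegative factor.\<close>
    have "(G / B - G * K / B\<^sup>2 / (real n)\<^sup>2) * sum_sq n c = (1 / B - t / B\<^sup>2) * (G * sum_sq n c)"
      by (simp add: t_def algebra_simps)
    also have "\<dots> \<le> sum_sq n y"
    proof (cases "1 / B - t / B\<^sup>2 \<ge> 0")
      case True
      then have "(1 / B - t / B\<^sup>2) * (G * sum_sq n c) \<le> (1 / B - t / B\<^sup>2) * ((B + t) * sum_sq n y)"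
        using up by (intro mult_left_mono)
      also have "\<dots> = (1 - (t / B)\<^sup>2) * sum_sq n y"
        using B by (simp add: field_simps power2_eq_square)
      also have "\<dots> \<le> 1 * sum_sq n y" using y(3) by (intro mult_right_mono) auto
      finally show ?thesis by simp
    next
      case False
      then have "(1 / B - t / B\<^sup>2) * (G * sum_sq n c) \<le> 0"
        using G cpos by (intro mult_nonpos_nonneg) auto
      then show ?thesis using y(3) by simp
    qed
    finally have "(\<phi> ^ (2 * p) - G * K / B\<^sup>2 / (real n)\<^sup>2) * sum_sq n c \<le> sum_sq n y"
      by (simp add: \<phi>)
    then show "\<exists>c. c 0 = 0 \<and> (\<forall>a\<ge>n. c a = 0) \<and>
        (\<forall>a\<ge>n. (scalar_sweep g \<mu> ^^ p) c a = 0) \<and> sum_sq n c > 0 \<and>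
        (\<phi> ^ (2 * p) - G * K / B\<^sup>2 / (real n)\<^sup>2) * sum_sq n c
          \<le> sum_sq n ((scalar_sweep g \<mu> ^^ p) c)"
      using c cpos y(2) by (intro exI[of _ c]) auto
  qed
qed

lemma weighted_sq_zero [simp]: "weighted_sq w n (\<lambda>_. 0) = 0"
  by (simp add: weighted_sq_def)

lemma scalar_sweep_zero [simp]: "scalar_sweep g \<mu> (\<lambda>_. 0) = (\<lambda>_. 0)"
proof
  show "scalar_sweep g \<mu> (\<lambda>_. 0) a = 0" for a by (induction a) auto
qed

lemma scalar_sweep_pow_zero [simp]: "(scalar_sweep g \<mu> ^^ p) (\<lambda>_. 0) = (\<lambda>_. 0)"
  by (induction p) auto

lemma weighted_sq_sum_sq:
  "c n = 0 \<Longrightarrow> weighted_sq w n c = w * sum_sq n c"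
  by (simp add: weighted_sq_def sum_sq_def)

text \<open>One further backward step makes the slow sequence the first iterate of an initial error,
  as the bound compares with the first iterate.\<close>

lemma exists_slow_weighted:
  assumes \<mu>: "cmod \<mu> < 1" and g: "g \<noteq> 0" and w: "w \<ge> 1"
  defines "\<phi> \<equiv> cmod g / (1 - cmod \<mu>)"
  shows "\<exists>C\<ge>0. \<forall>n\<ge>1. \<exists>c. weighted_sq w n (scalar_sweep g \<mu> c) > 0 \<and>
    (\<phi> ^ (2 * p) - C / (real n)\<^sup>2) * weighted_sq w n (scalar_sweep g \<mu> c)
      \<le> weighted_sq w n ((scalar_sweep g \<mu> ^^ Suc p) c)"
proof -
  let ?S = "scalar_sweep g \<mu>"
  obtain C where C: "C \<ge> 0" "\<And>n. n \<ge> 6 + 2 * p \<Longrightarrow> \<exists>c. c 0 = 0 \<and> (\<forall>a\<ge>n. c a = 0) \<and>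
    (\<forall>a\<ge>n. (?S ^^ p) c a = 0) \<and> sum_sq n c > 0 \<and>
    (\<phi> ^ (2 * p) - C / (real n)\<^sup>2) * sum_sq n c \<le> sum_sq n ((?S ^^ p) c)"
    using exists_slow_sequence[OF \<mu> g, of p, folded \<phi>_def] by blast
  \<comment> \<open>The second summand makes the factor nonpositive for the finitely many
    \<open>n\<close> below the threshold, where any nonzero first iterate will do.\<close>
  define K where "K = C + \<phi> ^ (2 * p) * (real (6 + 2 * p))\<^sup>2"
  have \<phi>: "0 \<le> \<phi> ^ (2 * p)" by simp
  show ?thesis
  proof (intro exI[of _ K] conjI allI impI)
    show "0 \<le> K" using C \<phi> by (simp add: K_def)
    fix n :: nat assume n: "n \<ge> 1"
    show "\<exists>c. weighted_sq w n (?S c) > 0 \<and>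
      (\<phi> ^ (2 * p) - K / (real n)\<^sup>2) * weighted_sq w n (?S c)
        \<le> weighted_sq w n ((?S ^^ Suc p) c)"
    proof (cases "n \<ge> 6 + 2 * p")
      case True
      then obtain c where c: "c 0 = 0" "\<forall>a\<ge>n. c a = 0" "\<forall>a\<ge>n. (?S ^^ p) c a = 0" "sum_sq n c > 0"
        "(\<phi> ^ (2 * p) - C / (real n)\<^sup>2) * sum_sq n c \<le> sum_sq n ((?S ^^ p) c)"
        using C(2) by blast
      define c0 where "c0 = scalar_unsweep g \<mu> c"
      have S: "?S c0 = c" "(?S ^^ Suc p) c0 = (?S ^^ p) c"
        unfolding c0_def funpow_Suc_right using sweep_unsweep[where y = c, OF g c(1)] by simp_all
      have "C / (real n)\<^sup>2 \<le> K / (real n)\<^sup>2"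
        using \<phi> by (intro divide_right_mono) (auto simp: K_def)
      then have "(\<phi> ^ (2 * p) - K / (real n)\<^sup>2) * sum_sq n c
          \<le> (\<phi> ^ (2 * p) - C / (real n)\<^sup>2) * sum_sq n c"
        using c(4) by (intro mult_right_mono) auto
      also note c(5)
      finally have "w * ((\<phi> ^ (2 * p) - K / (real n)\<^sup>2) * sum_sq n c) \<le> w * sum_sq n ((?S ^^ p) c)"
        using w by (intro mult_left_mono) auto
      moreover have "weighted_sq w n (?S c0) = w * sum_sq n c"
        "weighted_sq w n ((?S ^^ Suc p) c0) = w * sum_sq n ((?S ^^ p) c)"
        unfolding S using c(2,3) by (auto intro: weighted_sq_sum_sq)
      moreover have "w * sum_sq n c > 0" using w c(4) by (intro mult_pos_pos) auto
      ultimately show ?thesis by (intro exI[of _ c0]) (simp only: mult.left_commute)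
    next
      case False
      define c :: "nat \<Rightarrow> complex" where "c a = (if a = 0 then 1 else 0)" for a
      have "?S c 1 = g" by (simp add: c_def)
      have "weighted_sq w n (?S c) > 0"
      proof (cases "n = 1")
        case True
        then show ?thesis using g by (simp add: weighted_sq_def c_def)
      next
        case False
        then have le: "(cmod (?S c 1))\<^sup>2 \<le> (\<Sum>a<n. (cmod (?S c a))\<^sup>2)"
          using n by (intro member_le_sum) auto
        have "(cmod (?S c 1))\<^sup>2 > 0" using g unfolding \<open>?S c 1 = g\<close> by simp
        from less_le_trans[OF this le] have "0 < w * (\<Sum>a<n. (cmod (?S c a))\<^sup>2)"
          using w by (intro mult_pos_pos) auto
        then show ?thesis unfolding weighted_sq_def by (simp add: add_pos_nonneg)
      qed
      moreover have "\<phi> ^ (2 * p) \<le> K / (real n)\<^sup>2"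
      proof -
        have "(real n)\<^sup>2 \<le> (real (6 + 2 * p))\<^sup>2" using False by (intro power_mono) auto
        then have "\<phi> ^ (2 * p) * (real n)\<^sup>2 \<le> \<phi> ^ (2 * p) * (real (6 + 2 * p))\<^sup>2"
          using \<phi> by (intro mult_left_mono)
        then have "\<phi> ^ (2 * p) * (real n)\<^sup>2 \<le> K" using C by (simp add: K_def)
        then show ?thesis using n by (simp add: pos_le_divide_eq)
      qed
      then have "(\<phi> ^ (2 * p) - K / (real n)\<^sup>2) * weighted_sq w n (?S c) \<le> 0"
        using \<open>weighted_sq w n (?S c) > 0\<close> by (intro mult_nonpos_nonneg) auto
      moreover have "0 \<le> weighted_sq w n ((?S ^^ Suc p) c)" using w by (intro weighted_sq_nonneg) simp
      ultimately show ?thesis by (intro exI[of _ c]) linarith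
    qed
  qed
qed

section \<open>Reduction to eigenvector coordinates\<close>

text \<open>The grid consists of \<open>Nc - 1\<close> full intervals of \<open>k\<close> points and
  one final C-point, which contributes only offset 0.\<close>

lemma sum_num_points:
  fixes f :: "nat \<Rightarrow> real"
  assumes "k \<ge> 1"
  shows "(\<Sum>i<num_points k Nc. (f (i mod k)) * h (i div k)) =
    (\<Sum>r<k. f r) * (\<Sum>a<Nc - 1. h a) + f 0 * h (Nc - 1)"
proof -
  have "(\<Sum>i<(Nc - 1) * k. f (i mod k) * h (i div k)) =
      (\<Sum>a<Nc - 1. \<Sum>i = a * k..<a * k + k. f (i mod k) * h (i div k))"
    by (rule sum.nat_group[symmetric])
  also have "\<dots> = (\<Sum>a<Nc - 1. \<Sum>r<k. f r * h a)"
  proof (rule sum.cong)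
    fix a
    have "(\<Sum>i = a * k..<a * k + k. f (i mod k) * h (i div k)) =
        (\<Sum>r = 0..<k. f ((r + a * k) mod k) * h ((r + a * k) div k))"
      using sum.shift_bounds_nat_ivl[of "\<lambda>i. f (i mod k) * h (i div k)" 0 "a * k" k]
      by (simp add: add.commute)
    also have "\<dots> = (\<Sum>r<k. f r * h a)" by (intro sum.cong) (auto simp: atLeast0LessThan)
    finally show "(\<Sum>i = a * k..<a * k + k. f (i mod k) * h (i div k)) = (\<Sum>r<k. f r * h a)" .
  qed simp
  also have "\<dots> = (\<Sum>r<k. f r) * (\<Sum>a<Nc - 1. h a)"
    by (simp add: sum_product sum.swap[of _ "{..<k}"])
  finally show ?thesis using assms by (simp add: num_points_def)
qed

definition coord :: "complex^'n^'n \<Rightarrow> 'n \<Rightarrow> complex^'n::finite \<Rightarrow> complex" where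
  "coord U l x = (matrix_inv U *v x) $ l"

lemma coord_add: "coord U l (x + y) = coord U l x + coord U l y"
  and coord_diff: "coord U l (x - y) = coord U l x - coord U l y"
  and coord_zero [simp]: "coord U l 0 = 0"
  and coord_scale: "coord U l (c *s x) = c * coord U l x"
  by (simp_all add: coord_def matrix_vector_right_distrib matrix_vector_mult_diff_distrib vec.scale)

lemma matrix_inv_inverse:
  assumes "invertible U"
  shows "U ** matrix_inv U = mat 1" "matrix_inv U ** U = mat 1"
  using someI_ex[OF assms[unfolded invertible_def]] by (auto simp: matrix_inv_def)

lemma coord_column:
  assumes "invertible (U :: complex^'n::finite^'n)"
  shows "coord U l (column m U) = (if l = m then 1 else 0)"
proof -
  have "coord U l (column m U) = (matrix_inv U ** U) $ l $ m"
    by (simp add: coord_def matrix_vector_mult_def matrix_matrix_mult_def column_def)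
  then show ?thesis using assms by (simp add: matrix_inv_inverse mat_def)
qed

lemma coord_eigen:
  fixes U :: "complex^'n::finite^'n"
  assumes U: "invertible U" and M: "\<And>l. M *v column l U = c l *s column l U"
  shows "coord U l (M *v x) = c l * coord U l x"
proof -
  define y where "y = matrix_inv U *v x"
  have "x = U *v y" using U by (simp add: y_def matrix_vector_mul_assoc matrix_inv_inverse)
  then have x: "x = (\<Sum>i\<in>UNIV. y $ i *s column i U)" by (simp add: matrix_mult_sum)
  have Mx: "M *v x = (\<Sum>i\<in>UNIV. y $ i *s (c i *s column i U))"
    unfolding x matrix_vector_mult_sum by (simp add: vec.scale M)
  then have "coord U l (M *v x) = (\<Sum>i\<in>UNIV. if i = l then y $ i * c i else 0)"
    unfolding coord_def Mx matrix_vector_mult_sum sum_component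
    by (intro sum.cong) (auto simp: coord_def[symmetric] coord_scale coord_column[OF U])
  then show ?thesis by (simp add: y_def coord_def mult.commute)
qed

lemma coord_matrix_power:
  assumes "\<And>x. coord U l (M *v x) = c * coord U l x"
  shows "coord U l (matrix_power M q *v x) = c ^ q * coord U l x"
  by (induction q) (simp_all add: assms matrix_vector_mul_assoc[symmetric])

section \<open>The eigenvector norm and the scalar form of the iteration\<close>

lemma l2_norm_sq: "(l2_norm N x)\<^sup>2 = (\<Sum>j<N. (norm (x j))\<^sup>2)"
  by (simp add: l2_norm_def L2_set_def sum_nonneg)

lemma l2_norm_nonneg: "0 \<le> l2_norm N x"
  by (simp add: l2_norm_def)

text \<open>The columns of \<open>U\<close> are orthonormal for this norm, so the modes separate
  even if \<open>U\<close> is far from unitary.\<close>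

lemma UU_norm_sq:
  fixes U :: "complex^'n::finite^'n"
  shows "(UU_norm U N x)\<^sup>2 = (\<Sum>l\<in>UNIV. \<Sum>j<N. (cmod (coord U l (x j)))\<^sup>2)"
proof -
  have "(norm v)\<^sup>2 = (\<Sum>l\<in>UNIV. (cmod (v $ l))\<^sup>2)" for v :: "complex^'n"
    by (simp add: norm_vec_def L2_set_def sum_nonneg)
  then show ?thesis
    unfolding UU_norm_def l2_norm_sq coord_def by (subst sum.swap) simp
qed

lemma UU_norm_nonneg: "0 \<le> UU_norm U N x"
  by (simp add: UU_norm_def l2_norm_nonneg)

text \<open>What the spectral argument uses of a time-stepping pair: the eigenvalue bounds come from
  the contractive matrix power, \<open>mu_nonzero\<close> from the invertibility of \<Psi>.\<close>

locale eigen_pair =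
  fixes \<Phi> \<Psi> U :: "complex^'n::finite^'n" and lam mu :: "'n \<Rightarrow> complex" and k :: nat
  assumes k: "k \<ge> 1" and inv: "invertible U"
    and eigen: "\<Phi> *v column l U = lam l *s column l U" "\<Psi> *v column l U = mu l *s column l U"
    and lam_less: "cmod (lam l) < 1" and mu_less: "cmod (mu l) < 1" and mu_nonzero: "mu l \<noteq> 0"
begin

definition gap :: "'n \<Rightarrow> complex" where
  "gap l = lam l ^ k - mu l"

definition weight :: "'n \<Rightarrow> real" where
  "weight l = (\<Sum>r<k. (cmod (lam l ^ r))\<^sup>2)"

abbreviation sweep :: "'n \<Rightarrow> (nat \<Rightarrow> complex) \<Rightarrow> nat \<Rightarrow> complex" where
  "sweep l \<equiv> scalar_sweep (gap l) (mu l)"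

abbreviation err :: "nat \<Rightarrow> nat \<Rightarrow> 'n block_vector \<Rightarrow> real" where
  "err Nc p e0 \<equiv> UU_norm U (num_points k Nc) (error_after k Nc \<Phi> \<Psi> p e0)"

lemma weight_bounds: "1 \<le> weight l" "weight l \<le> real k"
proof -
  have "(cmod (lam l ^ 0))\<^sup>2 \<le> weight l"
    unfolding weight_def using k by (intro member_le_sum) auto
  then show "1 \<le> weight l" by simp
  have "weight l \<le> (\<Sum>r<k. 1)"
    unfolding weight_def using lam_less[of l]
    by (intro sum_mono) (auto simp: norm_power power_le_one)
  then show "weight l \<le> real k" by simp
qed

lemma coord_\<Phi>: "coord U l (\<Phi> *v x) = lam l * coord U l x"
  and coord_\<Psi>: "coord U l (\<Psi> *v x) = mu l * coord U l x"
  by (rule coord_eigen[OF inv]; rule eigen)+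

lemma coord_coarse_sweep:
  "coord U l (coarse_sweep (matrix_power \<Phi> k) \<Psi> c a) = sweep l (\<lambda>b. coord U l (c b)) a"
  by (induction a)
     (simp_all add: coord_add coord_diff coord_\<Psi> coord_matrix_power[of U l \<Phi> "lam l"] coord_\<Phi>
       matrix_vector_mult_diff_rdistrib gap_def algebra_simps)

lemma coord_coarse_sweep_pow:
  "coord U l ((coarse_sweep (matrix_power \<Phi> k) \<Psi> ^^ p) c a) =
    (sweep l ^^ p) (\<lambda>b. coord U l (c b)) a"
  by (induction p arbitrary: a) (simp_all add: coord_coarse_sweep)

text \<open>The F-point at offset \<open>r\<close> carries \<open>lam l ^ r\<close> times its
  C-value; summing over an interval gives the weight.\<close>

lemma err_Suc_sq:
  assumes "Nc \<ge> 1"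
  shows "(err Nc (Suc p) e0)\<^sup>2 =
    (\<Sum>l\<in>UNIV. weighted_sq (weight l) (Nc - 1) ((sweep l ^^ Suc p) (\<lambda>b. coord U l (e0 (b * k)))))"
  unfolding UU_norm_sq
proof (rule sum.cong)
  fix l
  let ?c = "(sweep l ^^ Suc p) (\<lambda>b. coord U l (e0 (b * k)))"
  have "(\<Sum>j<num_points k Nc. (cmod (coord U l (error_after k Nc \<Phi> \<Psi> (Suc p) e0 j)))\<^sup>2) =
    (\<Sum>j<num_points k Nc. (cmod (lam l ^ (j mod k)))\<^sup>2 * (cmod (?c (j div k)))\<^sup>2)"
    by (intro sum.cong refl)
       (simp only: error_after_Suc[OF k assms] lessThan_iff coord_coarse_sweep_pow
         coord_matrix_power[of U l \<Phi> "lam l", OF coord_\<Phi>] norm_mult power_mult_distrib)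
  also have "\<dots> = weighted_sq (weight l) (Nc - 1) ?c"
    by (subst sum_num_points[OF k, of "\<lambda>r. (cmod (lam l ^ r))\<^sup>2" "\<lambda>a. (cmod (?c a))\<^sup>2"])
       (simp add: weighted_sq_def weight_def)
  finally show "(\<Sum>j<num_points k Nc. (cmod (coord U l (error_after k Nc \<Phi> \<Psi> (Suc p) e0 j)))\<^sup>2) =
    weighted_sq (weight l) (Nc - 1) ?c" .
qed simp

lemma sum_C_points_le:
  assumes "Nc \<ge> 1"
  shows "(\<Sum>l\<in>UNIV. \<Sum>a<Nc - 1. (cmod (coord U l (e0 (a * k))))\<^sup>2) \<le> (UU_norm U (num_points k Nc) e0)\<^sup>2"
  unfolding UU_norm_sq
proof (rule sum_mono)
  fix l
  have "(\<Sum>a<Nc - 1. (cmod (coord U l (e0 (a * k))))\<^sup>2) =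
      (\<Sum>j\<in>(\<lambda>a. a * k) ` {..<Nc - 1}. (cmod (coord U l (e0 j)))\<^sup>2)"
    using k by (subst sum.reindex) (auto simp: inj_on_def)
  also have "\<dots> \<le> (\<Sum>j<num_points k Nc. (cmod (coord U l (e0 j)))\<^sup>2)"
    by (intro sum_mono2) (auto simp: num_points_def less_Suc_eq_le)
  finally show "(\<Sum>a<Nc - 1. (cmod (coord U l (e0 (a * k))))\<^sup>2)
      \<le> (\<Sum>j<num_points k Nc. (cmod (coord U l (e0 j)))\<^sup>2)" .
qed

section \<open>The F-TEAP constant and the contraction of the vector error\<close>

lemma column_nonzero: "column l U \<noteq> 0"
  using coord_column[OF inv, of l l] by force

text \<open>A nonzero eigenvector determines its eigenvalue, so the existential choice in
  \<open>F_TEAP\<close> is no freedom.\<close>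

lemma F_TEAP_iff: "F_TEAP k \<Phi> \<Psi> U \<phi> \<longleftrightarrow> (\<forall>l. cmod (gap l) \<le> \<phi> * (1 - cmod (mu l)))"
proof
  assume "F_TEAP k \<Phi> \<Psi> U \<phi>"
  then obtain lam' mu' where
    *: "\<And>l. \<Phi> *v column l U = lam' l *s column l U \<and> \<Psi> *v column l U = mu' l *s column l U"
      "\<And>l. cmod (mu' l - lam' l ^ k) \<le> \<phi> * (1 - cmod (mu' l))"
    unfolding F_TEAP_def by blast
  have "lam' l = lam l" "mu' l = mu l" for l
    using *(1)[of l] eigen[of l] column_nonzero[of l] by (auto simp: vec.scale_right_imp_eq)
  then show "\<forall>l. cmod (gap l) \<le> \<phi> * (1 - cmod (mu l))"
    using *(2) by (auto simp: gap_def norm_minus_commute)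
next
  assume "\<forall>l. cmod (gap l) \<le> \<phi> * (1 - cmod (mu l))"
  then show "F_TEAP k \<Phi> \<Psi> U \<phi>"
    unfolding F_TEAP_def using eigen
    by (intro exI[of _ lam] exI[of _ mu]) (auto simp: gap_def norm_minus_commute)
qed

lemma F_TEAP_nonneg:
  assumes "F_TEAP k \<Phi> \<Psi> U \<phi>"
  shows "\<phi> \<ge> 0"
proof -
  have "0 \<le> \<phi> * (1 - cmod (mu undefined))"
    using assms norm_ge_zero order_trans unfolding F_TEAP_iff by blast
  then show ?thesis using mu_less[of undefined] by (simp add: zero_le_mult_iff)
qed

text \<open>The factor \<open>k\<close> bounds the weight against the plain C-values of
  \<open>e0\<close>. The factor \<open>\<phi>\<^sup>2\<close> is kept because it shows that the
  first iterate vanishes for \<open>\<phi> = 0\<close>.\<close>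

lemma err_one_le:
  assumes \<phi>: "F_TEAP k \<Phi> \<Psi> U \<phi>" and Nc: "Nc \<ge> 1"
  shows "(err Nc 1 e0)\<^sup>2 \<le> \<phi>\<^sup>2 * real k * (UU_norm U (num_points k Nc) e0)\<^sup>2"
proof -
  let ?c = "\<lambda>l b. coord U l (e0 (b * k))"
  have "(err Nc 1 e0)\<^sup>2 = (\<Sum>l\<in>UNIV. weighted_sq (weight l) (Nc - 1) (sweep l (?c l)))"
    using err_Suc_sq[OF Nc, of 0 e0] by simp
  also have "\<dots> \<le> (\<Sum>l\<in>UNIV. \<phi>\<^sup>2 * real k * (\<Sum>a<Nc - 1. (cmod (?c l a))\<^sup>2))"
  proof (rule sum_mono)
    fix l
    have "weighted_sq (weight l) (Nc - 1) (sweep l (?c l))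
        \<le> \<phi>\<^sup>2 * (1 - 0 / (real Nc)\<^sup>2) * (weight l * (\<Sum>a<Nc - 1. (cmod (?c l a))\<^sup>2))"
      using \<phi> Nc by (intro weighted_sq_sweep_le weight_bounds mu_less) (auto simp: F_TEAP_iff)
    also have "\<dots> \<le> \<phi>\<^sup>2 * (real k * (\<Sum>a<Nc - 1. (cmod (?c l a))\<^sup>2))"
      using weight_bounds[of l] by (auto intro!: mult_left_mono mult_right_mono sum_nonneg)
    finally show "weighted_sq (weight l) (Nc - 1) (sweep l (?c l))
        \<le> \<phi>\<^sup>2 * real k * (\<Sum>a<Nc - 1. (cmod (?c l a))\<^sup>2)" by (simp only: mult.assoc)
  qed
  also have "\<dots> \<le> \<phi>\<^sup>2 * real k * (UU_norm U (num_points k Nc) e0)\<^sup>2"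
    unfolding sum_distrib_left[symmetric]
    by (intro mult_left_mono sum_C_points_le[OF Nc]) auto
  finally show ?thesis .
qed

text \<open>Both sides now carry the weights of the same modes, so no factor \<open>k\<close>
  appears.\<close>

lemma err_Suc_le:
  assumes \<phi>: "F_TEAP k \<Phi> \<Psi> U \<phi>" and Nc: "Nc \<ge> 1" and \<kappa>: "0 \<le> \<kappa>" "\<And>l. \<kappa> \<le> cmod (mu l)"
  shows "(err Nc (Suc (Suc p)) e0)\<^sup>2 \<le> \<phi>\<^sup>2 * (1 - \<kappa> / (real Nc)\<^sup>2) * (err Nc (Suc p) e0)\<^sup>2"
proof -
  let ?c = "\<lambda>l. (sweep l ^^ Suc p) (\<lambda>b. coord U l (e0 (b * k)))"
  let ?r = "\<phi>\<^sup>2 * (1 - \<kappa> / (real Nc)\<^sup>2)"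
  have "\<kappa> / (real Nc)\<^sup>2 \<le> \<kappa> / 1" using \<kappa> Nc by (intro divide_left_mono) auto
  also have "\<dots> \<le> 1" using \<kappa>(2)[of undefined] mu_less[of undefined] by linarith
  finally have r: "?r \<ge> 0" by simp
  have "(err Nc (Suc (Suc p)) e0)\<^sup>2 = (\<Sum>l\<in>UNIV. weighted_sq (weight l) (Nc - 1) (sweep l (?c l)))"
    using err_Suc_sq[OF Nc, of "Suc p" e0] by simp
  also have "\<dots> \<le> (\<Sum>l\<in>UNIV. ?r * weighted_sq (weight l) (Nc - 1) (?c l))"
  proof (rule sum_mono)
    fix l
    have "weighted_sq (weight l) (Nc - 1) (sweep l (?c l))
        \<le> ?r * (weight l * (\<Sum>a<Nc - 1. (cmod (?c l a))\<^sup>2))"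
      using \<phi> Nc \<kappa> by (intro weighted_sq_sweep_le weight_bounds mu_less) (auto simp: F_TEAP_iff)
    also have "\<dots> \<le> ?r * weighted_sq (weight l) (Nc - 1) (?c l)"
      using r by (intro mult_left_mono) (auto simp: weighted_sq_def)
    finally show "weighted_sq (weight l) (Nc - 1) (sweep l (?c l))
        \<le> ?r * weighted_sq (weight l) (Nc - 1) (?c l)" .
  qed
  also have "\<dots> = ?r * (err Nc (Suc p) e0)\<^sup>2"
    unfolding err_Suc_sq[OF Nc] sum_distrib_left ..
  finally show ?thesis .
qed

lemma err_Suc_pow_le:
  assumes \<phi>: "F_TEAP k \<Phi> \<Psi> U \<phi>" and Nc: "Nc \<ge> 1" and \<kappa>: "0 \<le> \<kappa>" "\<And>l. \<kappa> \<le> cmod (mu l)"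
  shows "(err Nc (Suc p) e0)\<^sup>2 \<le> (\<phi>\<^sup>2 * (1 - \<kappa> / (real Nc)\<^sup>2)) ^ p * (err Nc 1 e0)\<^sup>2"
proof (induction p)
  case (Suc p)
  let ?r = "\<phi>\<^sup>2 * (1 - \<kappa> / (real Nc)\<^sup>2)"
  have "\<kappa> / (real Nc)\<^sup>2 \<le> \<kappa> / 1" using \<kappa> Nc by (intro divide_left_mono) auto
  also have "\<dots> \<le> 1" using \<kappa>(2)[of undefined] mu_less[of undefined] by linarith
  finally have r: "?r \<ge> 0" by simp
  have "(err Nc (Suc (Suc p)) e0)\<^sup>2 \<le> ?r * (err Nc (Suc p) e0)\<^sup>2" by (rule err_Suc_le[OF assms])
  also have "\<dots> \<le> ?r * (?r ^ p * (err Nc 1 e0)\<^sup>2)" using r Suc by (intro mult_left_mono)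
  finally show ?case by (simp only: power_Suc mult.assoc)
qed simp


end

section \<open>Uniform convergence and equivalence of norms\<close>

text \<open>The equivalence constants do not depend on \<open>N\<close>, so
  \<open>\<epsilon>\<close> can be rescaled once for all grids.\<close>

lemma asymptotically_convergent_cong:
  assumes C: "C > 0" "D > 0"
    and le: "\<And>N x. nrm N x \<le> C * nrm' N x" "\<And>N x. nrm' N x \<le> D * nrm N x"
    and conv: "asymptotically_convergent nrm' k \<Phi> \<Psi>"
  shows "asymptotically_convergent nrm k \<Phi> \<Psi>"
  unfolding asymptotically_convergent_def
proof (intro allI impI)
  fix \<epsilon> :: real assume \<epsilon>: "\<epsilon> > 0"
  then have "\<epsilon> / (C * D) > 0" using C by simp
  then obtain P where P: "\<And>p Nc e0. p \<ge> P \<Longrightarrow> Nc \<ge> 1 \<Longrightarrow>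
      nrm' (num_points k Nc) (error_after k Nc \<Phi> \<Psi> p e0) \<le> \<epsilon> / (C * D) * nrm' (num_points k Nc) e0"
    using conv unfolding asymptotically_convergent_def by blast
  show "\<exists>P. \<forall>p\<ge>P. \<forall>Nc\<ge>1. \<forall>e0.
      nrm (num_points k Nc) (error_after k Nc \<Phi> \<Psi> p e0) \<le> \<epsilon> * nrm (num_points k Nc) e0"
  proof (intro exI[of _ P] allI impI)
    fix p Nc :: nat and e0 assume "p \<ge> P" "Nc \<ge> 1"
    let ?N = "num_points k Nc"
    have "nrm ?N (error_after k Nc \<Phi> \<Psi> p e0) \<le> C * nrm' ?N (error_after k Nc \<Phi> \<Psi> p e0)"
      by (rule le)
    also have "\<dots> \<le> C * (\<epsilon> / (C * D) * nrm' ?N e0)"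
      using C P[OF \<open>p \<ge> P\<close> \<open>Nc \<ge> 1\<close>] by (intro mult_left_mono) auto
    also have "\<dots> = \<epsilon> / D * nrm' ?N e0" using C by simp
    also have "\<dots> \<le> \<epsilon> / D * (D * nrm ?N e0)" using \<epsilon> C by (intro mult_left_mono le) auto
    also have "\<dots> = \<epsilon> * nrm ?N e0" using C by simp
    finally show "nrm ?N (error_after k Nc \<Phi> \<Psi> p e0) \<le> \<epsilon> * nrm ?N e0" .
  qed
qed

lemma l2_norm_mono:
  assumes "\<And>j. j < N \<Longrightarrow> norm (x j) \<le> B * norm (y j)" "B \<ge> 0"
  shows "l2_norm N x \<le> B * l2_norm N y"
proof -
  have "l2_norm N x \<le> L2_set (\<lambda>j. B * norm (y j)) {..<N}"
    unfolding l2_norm_def using assms by (intro L2_set_mono) auto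
  then show ?thesis using assms(2) by (simp add: l2_norm_def L2_set_right_distrib)
qed

lemma norm_matrix_vector_le: "norm (M *v x) \<le> onorm ((*v) M) * norm x"
  for M :: "complex^'n^'n"
  by (rule onorm) simp

text \<open>The two-sided bound starts at 2 because with a single C-point the first iterate is zero
  and determines no ratio.\<close>

lemma order_termI:
  assumes "c > 0" "\<And>Nc. Nc \<ge> 1 \<Longrightarrow> \<epsilon> Nc > 0"
    and "\<And>Nc. Nc \<ge> 2 \<Longrightarrow> c / (real Nc)\<^sup>2 \<le> \<epsilon> Nc" "\<And>Nc. Nc \<ge> 2 \<Longrightarrow> \<epsilon> Nc \<le> C / (real Nc)\<^sup>2"
  shows "order_term \<epsilon>"
  unfolding order_term_def
proof (intro conjI allI impI bigthetaI)
  have pos: "\<epsilon> Nc \<ge> 0" if "Nc \<ge> 2" for Nc using assms(2)[of Nc] that by simp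
  have "\<forall>\<^sub>F Nc in sequentially. norm (\<epsilon> Nc) \<le> C * norm (1 / (real Nc)\<^sup>2)"
    using eventually_ge_at_top[of 2] by eventually_elim (use assms(4) pos in simp)
  then show "\<epsilon> \<in> O(\<lambda>Nc. 1 / (real Nc)\<^sup>2)" by (rule bigoI)
  have "\<forall>\<^sub>F Nc in sequentially. norm (\<epsilon> Nc) \<ge> c * norm (1 / (real Nc)\<^sup>2)"
    using eventually_ge_at_top[of 2] by eventually_elim (use assms(3) pos in simp)
  then show "\<epsilon> \<in> \<Omega>(\<lambda>Nc. 1 / (real Nc)\<^sup>2)" using assms(1) by (intro landau_omega.bigI)
qed (use assms(2) in auto)

lemma order_term_inverse_square: "c > 0 \<Longrightarrow> order_term (\<lambda>Nc. c / (real Nc)\<^sup>2)"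
  by (rule order_termI[of c _ c]) auto

lemma block_apply_bidiag:
  assumes "j < N"
  shows "block_apply {..<N} (bidiag \<Phi>) x j = x j - (if j = 0 then 0 else \<Phi> *v x (j - 1))"
proof -
  have "block_apply {..<N} (bidiag \<Phi>) x j =
      (\<Sum>i<N. (if i = j then x i else 0) - (if i = j - 1 then if j > 0 then \<Phi> *v x i else 0 else 0))"
    unfolding block_apply_def by (intro sum.cong) (auto simp: bidiag_def matrix_vector_mult_minus_left)
  then show ?thesis using assms by (auto simp: sum_subtractf)
qed

section \<open>Sharpness of the contraction factor and necessity of the F-TEAP\<close>

context eigen_pair
begin

text \<open>A single mode placed on the C-points. The F-values are set to 0: the iteration ignores
  them, and they add nothing to the initial norm.\<close>

definition embed :: "'n \<Rightarrow> (nat \<Rightarrow> complex) \<Rightarrow> 'n block_vector" where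
  "embed l c j = (if k dvd j then c (j div k) *s column l U else 0)"

lemma coord_embed:
  "coord U l' (embed l c (b * k)) = (if l' = l then c b else 0)"
  using k by (simp add: embed_def coord_scale coord_column[OF inv])

lemma err_Suc_embed:
  assumes "Nc \<ge> 1"
  shows "(err Nc (Suc p) (embed l c))\<^sup>2 =
    weighted_sq (weight l) (Nc - 1) ((sweep l ^^ Suc p) c)"
proof -
  have "weighted_sq (weight l') (Nc - 1) ((sweep l' ^^ Suc p) (\<lambda>b. coord U l' (embed l c (b * k)))) =
    (if l' = l then weighted_sq (weight l') (Nc - 1) ((sweep l' ^^ Suc p) c) else 0)" for l'
    unfolding coord_embed by (cases "l' = l") (simp_all del: funpow.simps)
  then show ?thesis unfolding err_Suc_sq[OF assms] by (simp del: funpow.simps)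
qed

lemma UU_norm_embed:
  assumes Nc: "Nc \<ge> 1"
  shows "(UU_norm U (num_points k Nc) (embed l c))\<^sup>2 = weighted_sq 1 (Nc - 1) c"
proof -
  have "(\<Sum>j<num_points k Nc. (cmod (coord U l' (embed l c j)))\<^sup>2) =
      (if l' = l then weighted_sq 1 (Nc - 1) c else 0)" for l'
  proof -
    let ?f = "\<lambda>r. if r = (0::nat) then 1 else 0 :: real"
    have "(\<Sum>j<num_points k Nc. (cmod (coord U l' (embed l c j)))\<^sup>2) =
        (\<Sum>j<num_points k Nc. ?f (j mod k) * (if l' = l then (cmod (c (j div k)))\<^sup>2 else 0))"
      by (intro sum.cong)
         (auto simp: embed_def coord_scale coord_column[OF inv] dvd_eq_mod_eq_0)
    also have "\<dots> = (\<Sum>r<k. ?f r) * (\<Sum>a<Nc - 1. if l' = l then (cmod (c a))\<^sup>2 else 0)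
        + ?f 0 * (if l' = l then (cmod (c (Nc - 1)))\<^sup>2 else 0)"
      by (rule sum_num_points[OF k])
    also have "(\<Sum>r<k. ?f r) = 1" using k by simp
    finally show ?thesis by (simp add: weighted_sq_def)
  qed
  then show ?thesis by (simp add: UU_norm_sq)
qed

text \<open>The least constant is a maximum of finitely many quotients, hence attained by a mode.
  Tightness concerns this constant, since every larger one is admissible too.\<close>

lemma minimal_F_TEAP_attained:
  assumes \<phi>: "F_TEAP k \<Phi> \<Psi> U \<phi>" and min: "\<And>\<phi>'. F_TEAP k \<Phi> \<Psi> U \<phi>' \<Longrightarrow> \<phi> \<le> \<phi>'"
  obtains l where "cmod (gap l) = \<phi> * (1 - cmod (mu l))"
proof -
  let ?r = "\<lambda>l. cmod (gap l) / (1 - cmod (mu l))"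
  obtain l where l: "?r l = Max (range ?r)"
    using Max_in[of "range ?r"] by (auto simp: image_iff)
  have "cmod (gap l') \<le> ?r l * (1 - cmod (mu l'))" for l'
  proof -
    have "?r l' \<le> ?r l" unfolding l by (intro Max_ge) auto
    then show ?thesis using mu_less[of l'] by (simp add: pos_divide_le_eq)
  qed
  then have "\<phi> \<le> ?r l" by (intro min) (simp add: F_TEAP_iff)
  moreover have "?r l \<le> \<phi>" using \<phi> mu_less[of l] by (simp add: F_TEAP_iff pos_divide_le_eq)
  ultimately have "?r l = \<phi>" by simp
  then have "cmod (gap l) = \<phi> * (1 - cmod (mu l))" using mu_less[of l] by (auto simp: field_simps)
  then show ?thesis by (rule that)
qed

lemma exists_gap_ge:
  assumes "\<not> (\<exists>\<phi><1. F_TEAP k \<Phi> \<Psi> U \<phi>)"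
  obtains l where "cmod (gap l) \<ge> 1 - cmod (mu l)"
proof -
  let ?r = "\<lambda>l. cmod (gap l) / (1 - cmod (mu l))"
  have "F_TEAP k \<Phi> \<Psi> U (Max (range ?r))"
    unfolding F_TEAP_iff
  proof
    fix l
    have "?r l \<le> Max (range ?r)" by (intro Max_ge) auto
    moreover have "1 - cmod (mu l) > 0" using mu_less[of l] by simp
    ultimately show "cmod (gap l) \<le> Max (range ?r) * (1 - cmod (mu l))"
      by (simp only: pos_divide_le_eq)
  qed
  then have "Max (range ?r) \<ge> 1" using assms not_le by blast
  moreover obtain l where "?r l = Max (range ?r)"
    using Max_in[of "range ?r"] by (auto simp: image_iff)
  ultimately have "?r l \<ge> 1" by simp
  then show ?thesis using mu_less[of l] that[of l] by (simp add: pos_le_divide_eq)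
qed

lemma UU_norm_nonzero_exists:
  assumes "Nc \<ge> 1"
  shows "\<exists>e0. UU_norm U (num_points k Nc) e0 \<noteq> 0"
proof -
  have "(UU_norm U (num_points k Nc) (embed l (\<lambda>_. 1)))\<^sup>2 \<noteq> 0" for l
    unfolding UU_norm_embed[OF assms] weighted_sq_def by simp
  then show ?thesis by (metis power2_eq_square mult_zero_left)
qed

text \<open>The uniform \<open>\<kappa>\<close> behind the gain of order 1/Nc^2; finitely many modes
  and \<open>mu_nonzero\<close> make it positive.\<close>

lemma mu_lower_bound:
  obtains \<kappa> where "0 < \<kappa>" "\<kappa> \<le> 1" "\<And>l. \<kappa> \<le> cmod (mu l)"
proof
  let ?\<kappa> = "Min (range (\<lambda>l. cmod (mu l)))"
  show "0 < ?\<kappa>" using mu_nonzero by (subst Min_gr_iff) auto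
  show le: "?\<kappa> \<le> cmod (mu l)" for l by (intro Min_le) auto
  show "?\<kappa> \<le> 1" using le[of undefined] mu_less[of undefined] by linarith
qed

lemma contraction_bound:
  assumes \<phi>: "F_TEAP k \<Phi> \<Psi> U \<phi>" and p: "p \<ge> 1"
  obtains c where "c > 0" "\<And>Nc e0. Nc \<ge> 1 \<Longrightarrow>
    (err Nc (p + 1) e0)\<^sup>2 \<le> (\<phi> ^ (2 * p) - c / (real Nc)\<^sup>2) * (err Nc 1 e0)\<^sup>2"
proof -
  obtain \<kappa> where \<kappa>: "0 < \<kappa>" "\<kappa> \<le> 1" "\<And>l. \<kappa> \<le> cmod (mu l)" by (rule mu_lower_bound) blast
  \<comment> \<open>For \<open>\<phi> \<noteq> 0\<close> this comes from (1-x)^p \<le> 1-x, valid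
    for \<open>p\<close> \<ge> 1. For \<open>\<phi> = 0\<close> both errors vanish and any positive
    constant serves.\<close>
  define c where "c = (if \<phi> = 0 then 1 else \<phi> ^ (2 * p) * \<kappa>)"
  show ?thesis
  proof (rule that)
    show "c > 0" using \<kappa> by (auto simp: c_def power_mult)
    fix Nc :: nat and e0 assume Nc: "Nc \<ge> 1"
    have "1 \<le> (real Nc)\<^sup>2" using Nc by simp
    with \<kappa>(2) have \<kappa>N: "\<kappa> / (real Nc)\<^sup>2 \<le> 1" by (simp add: divide_le_eq)
    have le: "(err Nc (p + 1) e0)\<^sup>2 \<le> (\<phi>\<^sup>2 * (1 - \<kappa> / (real Nc)\<^sup>2)) ^ p * (err Nc 1 e0)\<^sup>2"
      using err_Suc_pow_le[OF \<phi> Nc _ \<kappa>(3), of p e0] \<kappa> by simp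
    show "(err Nc (p + 1) e0)\<^sup>2 \<le> (\<phi> ^ (2 * p) - c / (real Nc)\<^sup>2) * (err Nc 1 e0)\<^sup>2"
    proof (cases "\<phi> = 0")
      case True
      then have "(err Nc 1 e0)\<^sup>2 \<le> 0" using err_one_le[OF \<phi> Nc, of e0] by simp
      then show ?thesis using le p by simp
    next
      case False
      have "(\<phi>\<^sup>2 * (1 - \<kappa> / (real Nc)\<^sup>2)) ^ p = \<phi> ^ (2 * p) * (1 - \<kappa> / (real Nc)\<^sup>2) ^ p"
        by (simp add: power_mult_distrib power_mult)
      also have "(1 - \<kappa> / (real Nc)\<^sup>2) ^ p \<le> (1 - \<kappa> / (real Nc)\<^sup>2) ^ 1"
        using \<kappa>N \<kappa> p by (intro power_decreasing) auto
      also have "\<phi> ^ (2 * p) * (1 - \<kappa> / (real Nc)\<^sup>2) ^ 1 = \<phi> ^ (2 * p) - c / (real Nc)\<^sup>2"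
        using False by (simp add: c_def right_diff_distrib)
      finally have "(\<phi>\<^sup>2 * (1 - \<kappa> / (real Nc)\<^sup>2)) ^ p \<le> \<phi> ^ (2 * p) - c / (real Nc)\<^sup>2"
        by (simp add: mult_left_mono)
      then show ?thesis using le by (meson mult_right_mono order_trans zero_le_power2)
    qed
  qed
qed

lemma slow_error:
  assumes l: "cmod (gap l) = \<phi> * (1 - cmod (mu l))" and \<phi>: "\<phi> > 0"
  obtains C where "\<And>Nc. Nc \<ge> 2 \<Longrightarrow> \<exists>e0. err Nc 1 e0 > 0 \<and>
    (\<phi> ^ (2 * p) - C / (real Nc)\<^sup>2) * (err Nc 1 e0)\<^sup>2 \<le> (err Nc (p + 1) e0)\<^sup>2"
proof -
  have gap: "gap l \<noteq> 0" using l \<phi> mu_less[of l] by auto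
  have \<phi>_eq: "\<phi> = cmod (gap l) / (1 - cmod (mu l))" using l mu_less[of l] by simp
  obtain C where C: "C \<ge> 0" "\<And>n. n \<ge> 1 \<Longrightarrow> \<exists>c. weighted_sq (weight l) n (sweep l c) > 0 \<and>
    (\<phi> ^ (2 * p) - C / (real n)\<^sup>2) * weighted_sq (weight l) n (sweep l c)
      \<le> weighted_sq (weight l) n ((sweep l ^^ Suc p) c)"
    using exists_slow_weighted[OF mu_less[of l] gap weight_bounds(1)[of l], of p, folded \<phi>_eq] by blast
  \<comment> \<open>The factor 4 passes from \<open>Nc - 1\<close> to \<open>Nc\<close>, using Nc -
    1 \<ge> Nc/2.\<close>
  show ?thesis
  proof (rule that[of "4 * C"])
    fix Nc :: nat assume Nc: "Nc \<ge> 2"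
    then have "Nc - 1 \<ge> 1" by simp
    from C(2)[OF this] obtain c where c: "weighted_sq (weight l) (Nc - 1) (sweep l c) > 0"
      "(\<phi> ^ (2 * p) - C / (real (Nc - 1))\<^sup>2) * weighted_sq (weight l) (Nc - 1) (sweep l c)
        \<le> weighted_sq (weight l) (Nc - 1) ((sweep l ^^ Suc p) c)"
      by blast
    let ?e = "embed l c"
    have e1: "(err Nc 1 ?e)\<^sup>2 = weighted_sq (weight l) (Nc - 1) (sweep l c)"
      using err_Suc_embed[of Nc 0 l c] Nc by simp
    have ep: "(err Nc (p + 1) ?e)\<^sup>2 = weighted_sq (weight l) (Nc - 1) ((sweep l ^^ Suc p) c)"
      using err_Suc_embed[of Nc p l c] Nc by simp
    have "C / (real (Nc - 1))\<^sup>2 \<le> C / (real Nc / 2)\<^sup>2"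
      using C Nc by (intro divide_left_mono power_mono) (auto simp: of_nat_diff)
    then have "(\<phi> ^ (2 * p) - 4 * C / (real Nc)\<^sup>2) * (err Nc 1 ?e)\<^sup>2
        \<le> (\<phi> ^ (2 * p) - C / (real (Nc - 1))\<^sup>2) * (err Nc 1 ?e)\<^sup>2"
      by (intro mult_right_mono) (auto simp: power_divide mult.commute)
    also have "\<dots> \<le> (err Nc (p + 1) ?e)\<^sup>2" unfolding e1 ep by (rule c)
    finally have "(\<phi> ^ (2 * p) - 4 * C / (real Nc)\<^sup>2) * (err Nc 1 ?e)\<^sup>2 \<le> (err Nc (p + 1) ?e)\<^sup>2" .
    moreover have "err Nc 1 ?e > 0"
      using c(1) e1 UU_norm_nonneg[of U "num_points k Nc" "error_after k Nc \<Phi> \<Psi> 1 ?e"]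
      by (metis less_le power_zero_numeral)
    ultimately show "\<exists>e0. err Nc 1 e0 > 0 \<and>
        (\<phi> ^ (2 * p) - 4 * C / (real Nc)\<^sup>2) * (err Nc 1 e0)\<^sup>2 \<le> (err Nc (p + 1) e0)\<^sup>2" by blast
  qed
qed

lemma bound_attained:
  assumes \<phi>: "F_TEAP k \<Phi> \<Psi> U \<phi>" and min: "\<And>\<phi>'. F_TEAP k \<Phi> \<Psi> U \<phi>' \<Longrightarrow> \<phi> \<le> \<phi>'"
    and p: "p \<ge> 1"
  shows "\<exists>\<delta>. order_term \<delta> \<and> (\<forall>Nc\<ge>2. \<exists>e0. UU_norm U (num_points k Nc) e0 \<noteq> 0 \<and>
    (\<phi> \<noteq> 0 \<longrightarrow> err Nc 1 e0 \<noteq> 0) \<and>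
    (err Nc (p + 1) e0)\<^sup>2 = (\<phi> ^ (2 * p) - \<delta> Nc) * (err Nc 1 e0)\<^sup>2)"
proof (cases "\<phi> = 0")
  case True
  have zero: "err Nc 1 e0 = 0" "err Nc (p + 1) e0 = 0" if "Nc \<ge> 1" for Nc e0
  proof -
    show *: "err Nc 1 e0 = 0" using err_one_le[OF \<phi> that, of e0] True by simp
    show "err Nc (p + 1) e0 = 0"
      using err_Suc_pow_le[OF \<phi> that, of 0 p e0] * by simp
  qed
  show ?thesis
  \<comment> \<open>All iterates vanish, so both sides are 0 for any nonzero initial error.\<close>
  proof (rule exI[of _ "\<lambda>Nc. 1 / (real Nc)\<^sup>2"], intro conjI allI impI)
    show "order_term (\<lambda>Nc. 1 / (real Nc)\<^sup>2)"
      by (rule order_term_inverse_square) simp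
    fix Nc :: nat assume Nc: "Nc \<ge> 2"
    then obtain e0 where "UU_norm U (num_points k Nc) e0 \<noteq> 0"
      using UU_norm_nonzero_exists[of Nc] by auto
    then show "\<exists>e0. UU_norm U (num_points k Nc) e0 \<noteq> 0 \<and> (\<phi> \<noteq> 0 \<longrightarrow> err Nc 1 e0 \<noteq> 0) \<and>
      (err Nc (p + 1) e0)\<^sup>2 =
        (\<phi> ^ (2 * p) - 1 / (real Nc)\<^sup>2) * (err Nc 1 e0)\<^sup>2"
      using zero[of Nc e0] Nc True by (intro exI[of _ e0]) auto
  qed
next
  case False
  then have pos: "\<phi> > 0" using F_TEAP_nonneg[OF \<phi>] by simp
  obtain l where l: "cmod (gap l) = \<phi> * (1 - cmod (mu l))"
    using minimal_F_TEAP_attained[OF \<phi> min] by blast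
  obtain C where C: "\<And>Nc. Nc \<ge> 2 \<Longrightarrow> \<exists>e0. err Nc 1 e0 > 0 \<and>
    (\<phi> ^ (2 * p) - C / (real Nc)\<^sup>2) * (err Nc 1 e0)\<^sup>2 \<le> (err Nc (p + 1) e0)\<^sup>2"
    using slow_error[OF l pos, of p] by blast
  obtain c where c: "c > 0" "\<And>Nc e0. Nc \<ge> 1 \<Longrightarrow>
    (err Nc (p + 1) e0)\<^sup>2 \<le> (\<phi> ^ (2 * p) - c / (real Nc)\<^sup>2) * (err Nc 1 e0)\<^sup>2"
    using contraction_bound[OF \<phi> p] by blast
  from C have "\<exists>e. \<forall>Nc\<ge>2. err Nc 1 (e Nc) > 0 \<and>
    (\<phi> ^ (2 * p) - C / (real Nc)\<^sup>2) * (err Nc 1 (e Nc))\<^sup>2 \<le> (err Nc (p + 1) (e Nc))\<^sup>2"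
    by (intro choice) blast
  then obtain e where e: "\<And>Nc. Nc \<ge> 2 \<Longrightarrow> err Nc 1 (e Nc) > 0"
    "\<And>Nc. Nc \<ge> 2 \<Longrightarrow> (\<phi> ^ (2 * p) - C / (real Nc)\<^sup>2) * (err Nc 1 (e Nc))\<^sup>2 \<le> (err Nc (p + 1) (e Nc))\<^sup>2"
    by blast
  \<comment> \<open>Equality holds by this choice; \<open>contraction_bound\<close> and
    \<open>slow_error\<close> then pin down its order. The value 1 below 2 only keeps it
    positive.\<close>
  define \<delta> where "\<delta> Nc = (if Nc < 2 then 1
    else \<phi> ^ (2 * p) - (err Nc (p + 1) (e Nc))\<^sup>2 / (err Nc 1 (e Nc))\<^sup>2)" for Nc
  have lower: "c / (real Nc)\<^sup>2 \<le> \<delta> Nc" if "Nc \<ge> 2" for Nc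
  proof -
    have "(err Nc (p + 1) (e Nc))\<^sup>2 / (err Nc 1 (e Nc))\<^sup>2 \<le> \<phi> ^ (2 * p) - c / (real Nc)\<^sup>2"
      using c(2)[of Nc "e Nc"] e(1)[OF that] that by (simp add: pos_divide_le_eq)
    then show ?thesis using that by (simp add: \<delta>_def)
  qed
  have upper: "\<delta> Nc \<le> C / (real Nc)\<^sup>2" if "Nc \<ge> 2" for Nc
  proof -
    have "\<phi> ^ (2 * p) - C / (real Nc)\<^sup>2 \<le> (err Nc (p + 1) (e Nc))\<^sup>2 / (err Nc 1 (e Nc))\<^sup>2"
      using e(2)[OF that] e(1)[OF that] by (simp add: pos_le_divide_eq)
    then show ?thesis using that by (simp add: \<delta>_def)
  qed
  have "order_term \<delta>"
  proof (rule order_termI[OF c(1) _ lower upper])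
    fix Nc :: nat assume "Nc \<ge> 1"
    show "\<delta> Nc > 0"
    proof (cases "Nc < 2")
      case False
      then have "0 < c / (real Nc)\<^sup>2" using c(1) by simp
      also have "\<dots> \<le> \<delta> Nc" using lower False by simp
      finally show ?thesis .
    qed (simp add: \<delta>_def)
  qed
  moreover have "UU_norm U (num_points k Nc) (e Nc) \<noteq> 0 \<and> err Nc 1 (e Nc) \<noteq> 0 \<and>
    (err Nc (p + 1) (e Nc))\<^sup>2 = (\<phi> ^ (2 * p) - \<delta> Nc) * (err Nc 1 (e Nc))\<^sup>2" if Nc: "Nc \<ge> 2" for Nc
  proof (intro conjI)
    show e1: "err Nc 1 (e Nc) \<noteq> 0" using e(1)[OF Nc] by simp
    show "UU_norm U (num_points k Nc) (e Nc) \<noteq> 0"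
    proof
      assume "UU_norm U (num_points k Nc) (e Nc) = 0"
      then show False using err_one_le[OF \<phi>, of Nc "e Nc"] Nc e1 by simp
    qed
    show "(err Nc (p + 1) (e Nc))\<^sup>2 = (\<phi> ^ (2 * p) - \<delta> Nc) * (err Nc 1 (e Nc))\<^sup>2"
      using e1 Nc by (simp add: \<delta>_def)
  qed
  ultimately show ?thesis by blast
qed

text \<open>Sufficiency: the bound \<open>\<phi> ^ p * sqrt k\<close> is free of \<open>Nc\<close>.
  Necessity: without a constant below 1 some mode has quotient at least 1, and on a long enough grid
  its slow sequence contradicts any fixed decay after a fixed number of iterations.\<close>

lemma convergent_UU_norm_iff:
  "(\<exists>\<phi><1. F_TEAP k \<Phi> \<Psi> U \<phi>) \<longleftrightarrow> asymptotically_convergent (UU_norm U) k \<Phi> \<Psi>"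
proof
  assume "\<exists>\<phi><1. F_TEAP k \<Phi> \<Psi> U \<phi>"
  then obtain \<phi> where \<phi>: "F_TEAP k \<Phi> \<Psi> U \<phi>" "\<phi> < 1" by blast
  have \<phi>0: "\<phi> \<ge> 0" by (rule F_TEAP_nonneg[OF \<phi>(1)])
  show "asymptotically_convergent (UU_norm U) k \<Phi> \<Psi>"
    unfolding asymptotically_convergent_def
  proof (intro allI impI)
    fix \<epsilon> :: real assume \<epsilon>: "\<epsilon> > 0"
    have k0: "sqrt (real k) > 0" using k by simp
    have "(\<lambda>p. \<phi> ^ p) \<longlonglongrightarrow> 0" using \<phi> \<phi>0 by (intro LIMSEQ_realpow_zero) auto
    then have "\<forall>\<^sub>F p in sequentially. \<phi> ^ p < \<epsilon> / sqrt (real k)"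
      using \<epsilon> k0 by (intro order_tendstoD) auto
    then obtain P where P: "\<And>p. p \<ge> P \<Longrightarrow> \<phi> ^ p < \<epsilon> / sqrt (real k)"
      by (auto simp: eventually_sequentially)
    show "\<exists>P. \<forall>p\<ge>P. \<forall>Nc\<ge>1. \<forall>e0. err Nc p e0 \<le> \<epsilon> * UU_norm U (num_points k Nc) e0"
    proof (intro exI[of _ "Suc P"] allI impI)
      fix p Nc :: nat and e0 assume p: "Suc P \<le> p" and Nc: "Nc \<ge> 1"
      obtain q where q: "p = Suc q" "q \<ge> P" using p by (cases p) auto
      have "(err Nc p e0)\<^sup>2 \<le> (\<phi>\<^sup>2) ^ q * (err Nc 1 e0)\<^sup>2"
        using err_Suc_pow_le[OF \<phi>(1) Nc, of 0 q e0] by (simp add: q)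
      also have "\<dots> \<le> (\<phi>\<^sup>2) ^ q * (\<phi>\<^sup>2 * real k * (UU_norm U (num_points k Nc) e0)\<^sup>2)"
        by (intro mult_left_mono err_one_le[OF \<phi>(1) Nc]) auto
      also have "\<dots> = (\<phi> ^ Suc q * sqrt (real k) * UU_norm U (num_points k Nc) e0)\<^sup>2"
        by (simp add: power_mult_distrib power_mult[symmetric] mult.commute)
      finally have "err Nc p e0 \<le> \<phi> ^ Suc q * sqrt (real k) * UU_norm U (num_points k Nc) e0"
        by (rule power2_le_imp_le) (use \<phi>0 in \<open>auto intro!: mult_nonneg_nonneg UU_norm_nonneg\<close>)
      also have "\<dots> \<le> \<epsilon> * UU_norm U (num_points k Nc) e0"
        using P[of "Suc q"] q k0
        by (intro mult_right_mono UU_norm_nonneg) (simp add: pos_less_divide_eq)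
      finally show "err Nc p e0 \<le> \<epsilon> * UU_norm U (num_points k Nc) e0" .
    qed
  qed
next
  assume conv: "asymptotically_convergent (UU_norm U) k \<Phi> \<Psi>"
  show "\<exists>\<phi><1. F_TEAP k \<Phi> \<Psi> U \<phi>"
  proof (rule ccontr)
    assume "\<not> (\<exists>\<phi><1. F_TEAP k \<Phi> \<Psi> U \<phi>)"
    then obtain l where l: "cmod (gap l) \<ge> 1 - cmod (mu l)" by (rule exists_gap_ge)
    define \<phi> where "\<phi> = cmod (gap l) / (1 - cmod (mu l))"
    have \<phi>: "\<phi> \<ge> 1" using l mu_less[of l] by (simp add: \<phi>_def)
    have gap: "gap l \<noteq> 0" using l mu_less[of l] by auto
    obtain P where P: "\<And>p Nc e0. p \<ge> P \<Longrightarrow> Nc \<ge> 1 \<Longrightarrow>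
        err Nc p e0 \<le> 1 / 2 * UU_norm U (num_points k Nc) e0"
      using conv unfolding asymptotically_convergent_def
      by (metis half_gt_zero zero_less_one)
    obtain C where C: "C \<ge> 0" "\<And>n. n \<ge> 6 + 2 * Suc P \<Longrightarrow> \<exists>c. c 0 = 0 \<and> (\<forall>a\<ge>n. c a = 0) \<and>
      (\<forall>a\<ge>n. (sweep l ^^ Suc P) c a = 0) \<and> sum_sq n c > 0 \<and>
      (\<phi> ^ (2 * Suc P) - C / (real n)\<^sup>2) * sum_sq n c \<le> sum_sq n ((sweep l ^^ Suc P) c)"
      using exists_slow_sequence[OF mu_less[of l] gap, of "Suc P", folded \<phi>_def] by blast
    \<comment> \<open>Large enough for the loss C/n^2 to be at most 1/2; the slow error then keeps
      half of its squared norm, while convergence with \<open>\<epsilon> = 1/2\<close> would leave a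
      quarter.\<close>
    define n where "n = 6 + 2 * Suc P + nat \<lceil>2 * C\<rceil>"
    have "2 * C \<le> real n" unfolding n_def using of_nat_ceiling[of "2 * C"] by linarith
    moreover have n1: "real n \<ge> 1" by (simp add: n_def)
    ultimately have "2 * C \<le> (real n)\<^sup>2"
      by (metis mult_left_le_one_le order_trans power2_eq_square self_le_power zero_less_numeral)
    then have Cn: "C / (real n)\<^sup>2 \<le> 1 / 2" using n1 by (simp add: pos_divide_le_eq)
    obtain c where c: "\<forall>a\<ge>n. c a = 0" "\<forall>a\<ge>n. (sweep l ^^ Suc P) c a = 0" "sum_sq n c > 0"
      "(\<phi> ^ (2 * Suc P) - C / (real n)\<^sup>2) * sum_sq n c \<le> sum_sq n ((sweep l ^^ Suc P) c)"
      using C(2)[of n] by (auto simp: n_def)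
    have "1 / 2 * sum_sq n c \<le> (\<phi> ^ (2 * Suc P) - C / (real n)\<^sup>2) * sum_sq n c"
      using c(3) Cn one_le_power[OF \<phi>, of "2 * Suc P"] by (intro mult_right_mono) linarith+
    also note c(4)
    also have "sum_sq n ((sweep l ^^ Suc P) c) \<le> weight l * sum_sq n ((sweep l ^^ Suc P) c)"
      using mult_right_mono[OF weight_bounds(1)[of l] sum_sq_nonneg] by simp
    also have "\<dots> = (err (Suc n) (Suc P) (embed l c))\<^sup>2"
      using err_Suc_embed[of "Suc n" P l c] c(2) weighted_sq_sum_sq by simp
    also have "\<dots> \<le> (1 / 2 * UU_norm U (num_points k (Suc n)) (embed l c))\<^sup>2"
      by (intro power_mono P UU_norm_nonneg) auto
    also have "\<dots> = 1 / 4 * sum_sq n c"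
      using UU_norm_embed[of "Suc n" l c] c(1) weighted_sq_sum_sq[of c n 1]
      by (simp add: power_mult_distrib power_divide)
    finally show False using c(3) by simp
  qed
qed

text \<open>\<open>U\<close> acts block by block, so the constants are independent of
  \<open>N\<close>; adding 1 makes them positive without further argument.\<close>

lemma UU_l2_equiv:
  obtains C D where "C > 0" "D > 0" "\<And>N x. l2_norm N x \<le> C * UU_norm U N x"
    "\<And>N x. UU_norm U N x \<le> D * l2_norm N x"
proof
  let ?C = "onorm ((*v) U) + 1" and ?D = "onorm ((*v) (matrix_inv U)) + 1"
  have pos: "onorm ((*v) M) \<ge> 0" for M :: "complex^'n^'n" by (rule onorm_pos_le) simp
  show "?C > 0" "?D > 0" using pos[of U] pos[of "matrix_inv U"] by linarith+
  fix N and x :: "'n block_vector"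
  have le: "norm (M *v v) \<le> (onorm ((*v) M) + 1) * norm v" for M :: "complex^'n^'n" and v
    unfolding distrib_right using norm_matrix_vector_le[of M v] norm_ge_zero[of v] by linarith
  show "UU_norm U N x \<le> ?D * l2_norm N x"
    unfolding UU_norm_def using le pos[of "matrix_inv U"] by (intro l2_norm_mono) auto
  have "x j = U *v (matrix_inv U *v x j)" for j
    using inv by (simp add: matrix_vector_mul_assoc matrix_inv_inverse)
  then have "norm (x j) \<le> ?C * norm (matrix_inv U *v x j)" for j
    using le[of U "matrix_inv U *v x j"] by simp
  then show "l2_norm N x \<le> ?C * UU_norm U N x"
    unfolding UU_norm_def using pos[of U] by (intro l2_norm_mono) auto
qed

section \<open>Bounds for the fine-grid matrix, uniform in the number of time points\<close>

lemma coord_bidiag_apply: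
  assumes "j < N"
  shows "coord U l (block_apply {..<N} (bidiag \<Phi>) x j) =
    coord U l (x j) - (if j = 0 then 0 else lam l * coord U l (x (j - 1)))"
  using assms by (simp add: block_apply_bidiag coord_diff coord_\<Phi>)

text \<open>In each coordinate the matrix is the identity minus a shift scaled by |lam| < 1.\<close>

lemma UU_norm_bidiag_le:
  "UU_norm U N (block_apply {..<N} (bidiag \<Phi>) x) \<le> 2 * UU_norm U N x"
proof (rule power2_le_imp_le)
  let ?A = "block_apply {..<N} (bidiag \<Phi>) x"
  show "0 \<le> 2 * UU_norm U N x" by (simp add: UU_norm_nonneg)
  have "(UU_norm U N ?A)\<^sup>2 \<le> (\<Sum>l\<in>UNIV. 4 * (\<Sum>j<N. (cmod (coord U l (x j)))\<^sup>2))"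
    unfolding UU_norm_sq
  proof (rule sum_mono)
    fix l
    let ?\<xi> = "\<lambda>j. coord U l (x j)" and ?s = "\<lambda>j. if j = 0 then 0 else coord U l (x (j - 1))"
    have "(\<Sum>j<N. (cmod (coord U l (?A j)))\<^sup>2) \<le> (\<Sum>j<N. 2 * (cmod (?\<xi> j))\<^sup>2 + 2 * (cmod (?s j))\<^sup>2)"
    proof (rule sum_mono)
      fix j assume "j \<in> {..<N}"
      then have eq: "coord U l (?A j) = ?\<xi> j - lam l * ?s j" by (simp add: coord_bidiag_apply)
      have "(cmod (lam l * ?s j))\<^sup>2 \<le> (cmod (?s j))\<^sup>2"
        using lam_less[of l] by (intro power_mono) (auto simp: norm_mult mult_left_le_one_le)
      then show "(cmod (coord U l (?A j)))\<^sup>2 \<le> 2 * (cmod (?\<xi> j))\<^sup>2 + 2 * (cmod (?s j))\<^sup>2"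
        unfolding eq using norm_diff_sq_le[of "?\<xi> j" "lam l * ?s j"] by linarith
    qed
    also have "\<dots> = 2 * (\<Sum>j<N. (cmod (?\<xi> j))\<^sup>2) + 2 * (\<Sum>j<N. (cmod (?s j))\<^sup>2)"
      by (simp add: sum.distrib sum_distrib_left)
    also have "(\<Sum>j<N. (cmod (?s j))\<^sup>2) \<le> (\<Sum>j<N. (cmod (?\<xi> j))\<^sup>2)"
    proof (cases N)
      case (Suc M)
      have "(\<Sum>j<N. (cmod (?s j))\<^sup>2) = (\<Sum>j<M. (cmod (?\<xi> j))\<^sup>2)"
        unfolding Suc by (subst sum.lessThan_Suc_shift) simp
      then show ?thesis by (simp add: Suc)
    qed simp
    finally show "(\<Sum>j<N. (cmod (coord U l (?A j)))\<^sup>2) \<le> 4 * (\<Sum>j<N. (cmod (?\<xi> j))\<^sup>2)" by simp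
  qed
  also have "\<dots> = (2 * UU_norm U N x)\<^sup>2"
    by (simp add: power_mult_distrib UU_norm_sq sum_distrib_left)
  finally show "(UU_norm U N ?A)\<^sup>2 \<le> (2 * UU_norm U N x)\<^sup>2" .
qed

text \<open>The lower bound for the sweep is reused with \<open>lam l\<close> in place of
  \<open>mu l\<close>; its Poincare gain is discarded, and the spectral distance to 1
  remains.\<close>

lemma UU_norm_le_bidiag:
  obtains C where "C > 0"
    "\<And>N x. UU_norm U N x \<le> C * UU_norm U N (block_apply {..<N} (bidiag \<Phi>) x)"
proof -
  define s where "s = Min (range (\<lambda>l. 1 - cmod (lam l)))"
  have s: "s > 0" using lam_less by (auto simp: s_def)
  have s_le: "s \<le> 1 - cmod (lam l)" for l unfolding s_def by (intro Min_le) auto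
  show ?thesis
  proof (rule that[of "1 / s"])
    show "1 / s > 0" using s by simp
    fix N and x :: "'n block_vector"
    let ?A = "block_apply {..<N} (bidiag \<Phi>) x"
    have "s\<^sup>2 * (UU_norm U N x)\<^sup>2 \<le> (UU_norm U N ?A)\<^sup>2"
      unfolding UU_norm_sq sum_distrib_left[of "s\<^sup>2" _ UNIV]
    proof (rule sum_mono)
      fix l
      \<comment> \<open>Shifted by one so that it starts at 0, as the estimate requires.\<close>
      define y where "y a = (if a = 0 then 0 else coord U l (x (a - 1)))" for a
      have X: "(\<Sum>j<N. (cmod (coord U l (x j)))\<^sup>2) = (\<Sum>a<N. (cmod (y (Suc a)))\<^sup>2)"
        by (simp add: y_def)
      have A: "(\<Sum>j<N. (cmod (coord U l (?A j)))\<^sup>2) = (\<Sum>a<N. (cmod (y (Suc a) - lam l * y a))\<^sup>2)"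
        by (intro sum.cong) (auto simp: y_def coord_bidiag_apply)
      let ?b = "(1 - cmod (lam l))\<^sup>2 + cmod (lam l) / (real (Suc N))\<^sup>2"
      have "s\<^sup>2 \<le> ?b" using s s_le[of l] by (intro add_increasing2 power_mono) auto
      then have "s\<^sup>2 * (\<Sum>a<N. (cmod (y (Suc a)))\<^sup>2) \<le> ?b * (\<Sum>a<N. (cmod (y (Suc a)))\<^sup>2)"
        by (intro mult_right_mono sum_nonneg) auto
      also have "\<dots> \<le> (\<Sum>a<N. (cmod (y (Suc a) - lam l * y a))\<^sup>2)"
        by (rule sum_diff_scaled_sq_ge) (auto simp: y_def lam_less)
      finally show "s\<^sup>2 * (\<Sum>j<N. (cmod (coord U l (x j)))\<^sup>2) \<le> (\<Sum>j<N. (cmod (coord U l (?A j)))\<^sup>2)"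
        unfolding X A .
    qed
    then have "(s * UU_norm U N x)\<^sup>2 \<le> (UU_norm U N ?A)\<^sup>2" by (simp add: power_mult_distrib)
    then have "s * UU_norm U N x \<le> UU_norm U N ?A"
      by (rule power2_le_imp_le) (rule UU_norm_nonneg)
    then show "UU_norm U N x \<le> 1 / s * UU_norm U N ?A" using s by (simp add: pos_le_divide_eq mult.commute)
  qed
qed

lemma convergent_l2_norm_iff:
  "(\<exists>\<phi><1. F_TEAP k \<Phi> \<Psi> U \<phi>) \<longleftrightarrow> asymptotically_convergent l2_norm k \<Phi> \<Psi>"
proof -
  obtain C D where "C > 0" "D > 0" "\<And>N x. l2_norm N x \<le> C * UU_norm U N x"
    "\<And>N x. UU_norm U N x \<le> D * l2_norm N x" by (rule UU_l2_equiv) blast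
  then show ?thesis unfolding convergent_UU_norm_iff
    using asymptotically_convergent_cong[of C D l2_norm "UU_norm U" k \<Phi> \<Psi>]
      asymptotically_convergent_cong[of D C "UU_norm U" l2_norm k \<Phi> \<Psi>] by blast
qed

lemma convergent_AA_norm_iff:
  "(\<exists>\<phi><1. F_TEAP k \<Phi> \<Psi> U \<phi>) \<longleftrightarrow> asymptotically_convergent (AA_norm \<Phi>) k \<Phi> \<Psi>"
proof -
  obtain C D where CD: "C > 0" "D > 0" "\<And>N x. l2_norm N x \<le> C * UU_norm U N x"
    "\<And>N x. UU_norm U N x \<le> D * l2_norm N (x :: 'n block_vector)" by (rule UU_l2_equiv) blast
  obtain B where B: "B > 0"
    "\<And>N x. UU_norm U N x \<le> B * UU_norm U N (block_apply {..<N} (bidiag \<Phi>) x)"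
    by (rule UU_norm_le_bidiag) blast
  have 1: "AA_norm \<Phi> N x \<le> (C * 2) * UU_norm U N x" for N x
  proof -
    have "AA_norm \<Phi> N x \<le> C * UU_norm U N (block_apply {..<N} (bidiag \<Phi>) x)"
      unfolding AA_norm_def by (rule CD)
    also have "\<dots> \<le> C * (2 * UU_norm U N x)"
      using CD by (intro mult_left_mono UU_norm_bidiag_le) auto
    finally show ?thesis by simp
  qed
  have 2: "UU_norm U N x \<le> (B * D) * AA_norm \<Phi> N x" for N x
  proof -
    have "UU_norm U N x \<le> B * UU_norm U N (block_apply {..<N} (bidiag \<Phi>) x)" by (rule B)
    also have "\<dots> \<le> B * (D * AA_norm \<Phi> N x)"
      unfolding AA_norm_def using B by (intro mult_left_mono CD) auto
    finally show ?thesis by simp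
  qed
  have "C * 2 > 0" "B * D > 0" using CD B by auto
  then show ?thesis unfolding convergent_UU_norm_iff
    using asymptotically_convergent_cong[of "C * 2" "B * D" "AA_norm \<Phi>" "UU_norm U" k \<Phi> \<Psi>]
      asymptotically_convergent_cong[of "B * D" "C * 2" "UU_norm U" "AA_norm \<Phi>" k \<Phi> \<Psi>] 1 2
    by blast
qed

end

section \<open>Transient growth for a nearly parallel pair of eigenvectors\<close>

lemma norm_vector_scale: "norm (c *s x) = cmod c * norm x" for x :: "complex^'n"
  by (simp add: norm_vec_def norm_mult L2_set_right_distrib)

lemma eigenvalue_less_one:
  fixes M :: "complex^'n::finite^'n"
  assumes u: "M *v u = c *s u" "u \<noteq> 0" and q: "onorm ((*v) (matrix_power M q)) < 1"
  shows "cmod c < 1"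
proof (rule ccontr)
  assume "\<not> cmod c < 1"
  have "matrix_power M q *v u = c ^ q *s u"
    by (induction q) (simp_all add: u vec.scale matrix_vector_mul_assoc[symmetric] mult.commute)
  then have "cmod c ^ q * norm u \<le> onorm ((*v) (matrix_power M q)) * norm u"
    using norm_matrix_vector_le[of "matrix_power M q" u] by (simp add: norm_vector_scale norm_power)
  moreover have "1 \<le> cmod c ^ q" using \<open>\<not> cmod c < 1\<close> by (intro one_le_power) simp
  ultimately show False using q u(2) by simp
qed

lemma time_stepping_pair_eigen_pair:
  assumes "k \<ge> 1" and pair: "time_stepping_pair \<Phi> \<Psi> U"
  shows "\<exists>lam mu. eigen_pair \<Phi> \<Psi> U lam mu k"
proof -
  have U: "invertible U" and inv: "invertible \<Psi>"
    using pair by (auto simp: time_stepping_pair_def diagonalizes_def)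
  obtain lam where lam: "\<And>l. \<Phi> *v column l U = lam l *s column l U"
    using pair unfolding time_stepping_pair_def diagonalizes_def by metis
  obtain mu where mu: "\<And>l. \<Psi> *v column l U = mu l *s column l U"
    using pair unfolding time_stepping_pair_def diagonalizes_def by metis
  have nz: "column l U \<noteq> 0" for l using coord_column[OF U, of l l] by force
  obtain q where q: "onorm ((*v) (matrix_power \<Phi> q)) < 1" "onorm ((*v) (matrix_power \<Psi> q)) < 1"
    using pair unfolding time_stepping_pair_def by blast
  have "mu l \<noteq> 0" for l
  proof
    assume "mu l = 0"
    then have "matrix_inv \<Psi> *v (\<Psi> *v column l U) = 0" by (simp add: mu)
    then show False using nz by (simp add: matrix_vector_mul_assoc matrix_inv_inverse[OF inv])
  qed
  then have "eigen_pair \<Phi> \<Psi> U lam mu k"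
    using assms(1) U lam mu eigenvalue_less_one[OF lam nz q(1)] eigenvalue_less_one[OF mu nz q(2)]
    by unfold_locales
  then show ?thesis by blast
qed

text \<open>Crude, but it makes the power bounds of the concrete example a matter of
  arithmetic.\<close>

lemma onorm_le_sum_entries:
  "onorm ((*v) M) \<le> (\<Sum>i\<in>UNIV. \<Sum>j\<in>UNIV. cmod (M $ i $ j))" for M :: "complex^'n::finite^'n"
proof (rule onorm_bound)
  fix x :: "complex^'n"
  have "norm (M *v x) \<le> (\<Sum>i\<in>UNIV. cmod ((M *v x) $ i))"
    unfolding norm_vec_def by (intro L2_set_le_sum) auto
  also have "\<dots> \<le> (\<Sum>i\<in>UNIV. \<Sum>j\<in>UNIV. cmod (M $ i $ j) * norm x)"
  proof (rule sum_mono)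
    fix i
    have "cmod ((M *v x) $ i) \<le> (\<Sum>j\<in>UNIV. cmod (M $ i $ j * x $ j))"
      by (simp add: matrix_vector_mult_def norm_sum)
    also have "\<dots> \<le> (\<Sum>j\<in>UNIV. cmod (M $ i $ j) * norm x)"
      by (intro sum_mono) (simp add: norm_mult mult_left_mono Finite_Cartesian_Product.norm_nth_le)
    finally show "cmod ((M *v x) $ i) \<le> (\<Sum>j\<in>UNIV. cmod (M $ i $ j) * norm x)" .
  qed
  finally show "norm (M *v x) \<le> (\<Sum>i\<in>UNIV. \<Sum>j\<in>UNIV. cmod (M $ i $ j)) * norm x"
    by (simp add: sum_distrib_right)
qed (simp add: sum_nonneg)

definition vec2 :: "complex \<Rightarrow> complex \<Rightarrow> complex^2" where
  "vec2 x y = vector [x, y]"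

definition mat2 :: "complex \<Rightarrow> complex \<Rightarrow> complex \<Rightarrow> complex \<Rightarrow> complex^2^2" where
  "mat2 a b c d = vector [vector [a, b], vector [c, d]]"

lemma mat2_simps:
  "mat2 a b c d *v vec2 x y = vec2 (a * x + b * y) (c * x + d * y)"
  "mat2 a b c d ** mat2 a' b' c' d' =
    mat2 (a * a' + b * c') (a * b' + b * d') (c * a' + d * c') (c * b' + d * d')"
  "mat2 a b c d - mat2 a' b' c' d' = mat2 (a - a') (b - b') (c - c') (d - d')"
  "mat 1 = mat2 1 0 0 1"
  "vec2 x y + vec2 x' y' = vec2 (x + x') (y + y')"
  "vec2 x y - vec2 x' y' = vec2 (x - x') (y - y')"
  "z *s vec2 x y = vec2 (z * x) (z * y)"
  "0 = vec2 0 0"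
  "column 1 (mat2 a b c d) = vec2 a c" "column 2 (mat2 a b c d) = vec2 b d"
  by (simp_all add: mat2_def vec2_def vec_eq_iff forall_2 sum_2 matrix_vector_mult_def
      matrix_matrix_mult_def mat_def column_def)

lemma norm_vec2_sq: "(norm (vec2 x y))\<^sup>2 = (cmod x)\<^sup>2 + (cmod y)\<^sup>2"
  by (simp add: norm_vec_def L2_set_def sum_2 vec2_def)

lemma invertible_mat2: "a * d \<noteq> b * c \<Longrightarrow> invertible (mat2 a b c d)"
  by (simp add: invertible_det_nz det_2 mat2_def)

lemma onorm_mat2_le: "onorm ((*v) (mat2 a b c d)) \<le> cmod a + cmod b + cmod c + cmod d"
  using onorm_le_sum_entries[of "mat2 a b c d"] by (simp add: sum_2 mat2_def)

text \<open>A scalar matrix commutes with everything and is diagonal in any basis, so the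
  eigenvectors (1,0) and (8,1) of \<open>Psi_ex\<close> can be nearly parallel. The quotients of the
  two modes for \<open>k = 2\<close> are 1/7 and 1/2.\<close>

definition Phi_ex :: "complex^2^2" where "Phi_ex = mat2 (1/2) 0 0 (1/2)"
definition Psi_ex :: "complex^2^2" where "Psi_ex = mat2 (1/8) 3 0 (1/2)"
definition U_ex :: "complex^2^2" where "U_ex = mat2 1 8 0 1"

text \<open>Chosen such that the first iterate is \<open>(0, 1)\<close> at the second C-point and zero at the other two.\<close>

definition e0_ex :: "2 block_vector" where
  "e0_ex j = (if j = 0 then vec2 (-96) (-4) else if j = 2 then vec2 24 2 else 0)"

lemma eigen_ex:
  "Phi_ex *v column l U_ex = 1/2 *s column l U_ex"
  "Psi_ex *v column l U_ex = (if l = 1 then 1/8 else 1/2) *s column l U_ex"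
  using exhaust_2[of l] by (auto simp: Phi_ex_def Psi_ex_def U_ex_def mat2_simps)

lemma time_stepping_pair_ex: "time_stepping_pair Phi_ex Psi_ex U_ex"
  unfolding time_stepping_pair_def diagonalizes_def
proof (intro conjI allI)
  show "\<exists>q. onorm ((*v) (matrix_power Phi_ex q)) < 1 \<and> onorm ((*v) (matrix_power Psi_ex q)) < 1"
  \<comment> \<open>4 is the first exponent for which the entry sum of the power of
    \<open>Psi_ex\<close> falls below 1.\<close>
  proof (intro exI[of _ 4] conjI)
    have "matrix_power Phi_ex 4 = mat2 (1/16) 0 0 (1/16)"
      by (simp add: eval_nat_numeral Phi_ex_def mat2_simps)
    then show "onorm ((*v) (matrix_power Phi_ex 4)) < 1"
      using onorm_mat2_le[of "1/16" 0 0 "1/16"] by (simp add: norm_divide)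
    have "matrix_power Psi_ex 4 = mat2 (1/4096) (255/512) 0 (1/16)"
      by (simp add: eval_nat_numeral Psi_ex_def mat2_simps)
    then show "onorm ((*v) (matrix_power Psi_ex 4)) < 1"
      using onorm_mat2_le[of "1/4096" "255/512" 0 "1/16"] by (simp add: norm_divide)
  qed
  show "\<exists>c. Phi_ex *v column l U_ex = c *s column l U_ex" for l using eigen_ex by blast
  show "\<exists>c. Psi_ex *v column l U_ex = c *s column l U_ex" for l using eigen_ex by blast
qed (auto simp: Phi_ex_def Psi_ex_def U_ex_def mat2_simps intro!: invertible_mat2)

lemma F_TEAP_ex: "F_TEAP 2 Phi_ex Psi_ex U_ex (1/2)"
  unfolding F_TEAP_def
proof (intro exI conjI allI)
  show "Phi_ex *v column l U_ex = (\<lambda>_. 1/2) l *s column l U_ex" for l using eigen_ex by blast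
  show "Psi_ex *v column l U_ex = (\<lambda>l. if l = 1 then 1/8 else 1/2) l *s column l U_ex" for l
    using eigen_ex by blast
  show "cmod ((\<lambda>l. if l = 1 then 1/8 else 1/2) l - (\<lambda>_. 1/2) l ^ 2)
      \<le> 1/2 * (1 - cmod ((\<lambda>l. if l = 1 then 1/8 else 1/2) l))" for l :: 2
  proof -
    have "(1/8 - (1/2)\<^sup>2 :: complex) = of_real (- (1/8))" "(1/2 - (1/2)\<^sup>2 :: complex) = of_real (1/4)"
      by (simp_all add: power2_eq_square)
    then have "cmod (1/8 - (1/2)\<^sup>2) = 1/8" "cmod (1/2 - (1/2)\<^sup>2) = 1/4"
      by (simp_all only: norm_of_real)
    then show ?thesis by (cases "l = 1") (simp_all add: norm_divide)
  qed
qed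

text \<open>The difference of the squared fine operator and \<open>Psi_ex\<close> has off-diagonal
  entry -3, so it sends (0,1) to (-3,-1/4): this is the growth.\<close>

lemma error_after_ex:
  assumes "i < 5"
  shows "error_after 2 3 Phi_ex Psi_ex 1 e0_ex i =
      (if i = 2 then vec2 0 1 else if i = 3 then vec2 0 (1/2) else 0)"
    and "error_after 2 3 Phi_ex Psi_ex 2 e0_ex i = (if i = 4 then vec2 (-3) (-1/4) else 0)"
proof -
  have N: "num_points 2 3 = 5" by (simp add: num_points_def)
  have i: "i < num_points 2 3" using assms by (simp add: N)
  have G: "matrix_power Phi_ex 2 = mat2 (1/4) 0 0 (1/4)"
    by (simp add: eval_nat_numeral Phi_ex_def mat2_simps)
  let ?S = "coarse_sweep (matrix_power Phi_ex 2) Psi_ex" and ?c = "\<lambda>b. e0_ex (b * 2)"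
  have c: "e0_ex 0 = vec2 (-96) (-4)" "e0_ex 2 = vec2 24 2" by (simp_all add: e0_ex_def)
  have s: "?S d 0 = vec2 0 0" "?S d 1 = Psi_ex *v vec2 0 0 + (matrix_power Phi_ex 2 - Psi_ex) *v d 0"
    "?S d 2 = Psi_ex *v ?S d 1 + (matrix_power Phi_ex 2 - Psi_ex) *v d 1" for d
    by (simp_all add: eval_nat_numeral mat2_simps(8))
  have 1: "?S ?c 0 = vec2 0 0" "?S ?c 1 = vec2 0 1" "?S ?c 2 = vec2 0 0"
    unfolding s by (simp_all add: G c Psi_ex_def mat2_simps)
  have 2: "?S (?S ?c) 0 = vec2 0 0" "?S (?S ?c) 1 = vec2 0 0" "?S (?S ?c) 2 = vec2 (-3) (-1/4)"
    unfolding s by (simp_all add: G c Psi_ex_def mat2_simps)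
  have i5: "i = 0 \<or> i = 1 \<or> i = 2 \<or> i = 3 \<or> i = 4" using assms by auto
  have "error_after 2 3 Phi_ex Psi_ex 1 e0_ex i = matrix_power Phi_ex (i mod 2) *v ?S ?c (i div 2)"
    using error_after_Suc[of 2 3 i Phi_ex Psi_ex 0 e0_ex] i by simp
  then show "error_after 2 3 Phi_ex Psi_ex 1 e0_ex i =
      (if i = 2 then vec2 0 1 else if i = 3 then vec2 0 (1/2) else 0)"
    using i5 1 by (auto simp: Phi_ex_def mat2_simps)
  have "error_after 2 3 Phi_ex Psi_ex 2 e0_ex i = matrix_power Phi_ex (i mod 2) *v ?S (?S ?c) (i div 2)"
    using error_after_Suc[of 2 3 i Phi_ex Psi_ex 1 e0_ex] i by (simp add: numeral_2_eq_2)
  then show "error_after 2 3 Phi_ex Psi_ex 2 e0_ex i = (if i = 4 then vec2 (-3) (-1/4) else 0)"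
    using i5 2 by (auto simp: Phi_ex_def mat2_simps)
qed

lemma sum_lessThan_5: "(\<Sum>j<5. f j) = f 0 + f 1 + f 2 + f 3 + f (4::nat)" for f :: "nat \<Rightarrow> real"
  by (simp add: eval_nat_numeral)

text \<open>Growth from the first to the second iterate is not due to the factor \<open>k\<close> of
  the first step: there the eigenvector norm already contracts, so it reflects the change of
  norm.\<close>

lemma error_growth_ex:
  "l2_norm (num_points 2 3) (error_after 2 3 Phi_ex Psi_ex 1 e0_ex)
    < l2_norm (num_points 2 3) (error_after 2 3 Phi_ex Psi_ex 2 e0_ex)"
  "AA_norm Phi_ex (num_points 2 3) (error_after 2 3 Phi_ex Psi_ex 1 e0_ex)
    < AA_norm Phi_ex (num_points 2 3) (error_after 2 3 Phi_ex Psi_ex 2 e0_ex)"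
proof -
  have N: "num_points 2 3 = 5" by (simp add: num_points_def)
  let ?e1 = "error_after 2 3 Phi_ex Psi_ex 1 e0_ex" and ?e2 = "error_after 2 3 Phi_ex Psi_ex 2 e0_ex"
  let ?A = "block_apply {..<5} (bidiag Phi_ex)"
  note e = error_after_ex[unfolded One_nat_def]
  have "(l2_norm 5 ?e1)\<^sup>2 < (l2_norm 5 ?e2)\<^sup>2"
    unfolding l2_norm_sq sum_lessThan_5
    by (simp add: e norm_vec2_sq norm_divide power_divide)
  then show "l2_norm (num_points 2 3) ?e1 < l2_norm (num_points 2 3) ?e2"
    unfolding N by (rule power2_less_imp_less) (rule l2_norm_nonneg)
  have "(l2_norm 5 (?A ?e1))\<^sup>2 < (l2_norm 5 (?A ?e2))\<^sup>2"
    unfolding l2_norm_sq sum_lessThan_5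
    by (simp add: block_apply_bidiag e, simp add: Phi_ex_def mat2_simps norm_vec2_sq norm_divide power_divide)
  then show "AA_norm Phi_ex (num_points 2 3) ?e1 < AA_norm Phi_ex (num_points 2 3) ?e2"
    unfolding N AA_norm_def by (rule power2_less_imp_less) (rule l2_norm_nonneg)
qed

text \<open>At \<open>p = 0\<close> no positive term could be subtracted from 1, and with one
  C-point the first iterate is zero; hence the ranges of \<open>p\<close> and \<open>Nc\<close>. The
  last conjunct makes initial divergence concrete.\<close>

theorem theorem2p12:
  fixes \<Phi> \<Psi> U :: "complex^'n::finite^'n" and k :: nat
  assumes "k \<ge> 1" and "time_stepping_pair \<Phi> \<Psi> U"
  shows
    "(\<forall>\<phi>. F_TEAP k \<Phi> \<Psi> U \<phi> \<and> \<phi> < 1 \<longrightarrow>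
        (\<forall>Nc\<ge>1. \<forall>e0.
           (UU_norm U (num_points k Nc) (error_after k Nc \<Phi> \<Psi> 1 e0))\<^sup>2
             \<le> real k * (UU_norm U (num_points k Nc) e0)\<^sup>2) \<and>
        (\<forall>p\<ge>1.
           (\<exists>\<epsilon>. order_term \<epsilon> \<and>
              (\<forall>Nc\<ge>1. \<forall>e0.
                 (UU_norm U (num_points k Nc) (error_after k Nc \<Phi> \<Psi> (p + 1) e0))\<^sup>2
                   \<le> (\<phi> ^ (2 * p) - \<epsilon> Nc)
                      * (UU_norm U (num_points k Nc) (error_after k Nc \<Phi> \<Psi> 1 e0))\<^sup>2)) \<and>
           ((\<forall>\<phi>'. F_TEAP k \<Phi> \<Psi> U \<phi>' \<longrightarrow> \<phi> \<le> \<phi>') \<longrightarrow>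
              (\<exists>\<delta>. order_term \<delta> \<and>
                 (\<forall>Nc\<ge>2. \<exists>e0.
                    UU_norm U (num_points k Nc) e0 \<noteq> 0 \<and>
                    (\<phi> \<noteq> 0 \<longrightarrow>
                       UU_norm U (num_points k Nc) (error_after k Nc \<Phi> \<Psi> 1 e0) \<noteq> 0) \<and>
                    (UU_norm U (num_points k Nc) (error_after k Nc \<Phi> \<Psi> (p + 1) e0))\<^sup>2
                      = (\<phi> ^ (2 * p) - \<delta> Nc)
                         * (UU_norm U (num_points k Nc) (error_after k Nc \<Phi> \<Psi> 1 e0))\<^sup>2)))))
     \<and> ((\<exists>\<phi><1. F_TEAP k \<Phi> \<Psi> U \<phi>) \<longleftrightarrow> asymptotically_convergent l2_norm k \<Phi> \<Psi>)
     \<and> ((\<exists>\<phi><1. F_TEAP k \<Phi> \<Psi> U \<phi>) \<longleftrightarrow> asymptotically_convergent (AA_norm \<Phi>) k \<Phi> \<Psi>)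
     \<and> (\<exists>(\<Phi>' :: complex^2^2) \<Psi>' U' k' \<phi> Nc e0.
          k' \<ge> 2 \<and> time_stepping_pair \<Phi>' \<Psi>' U' \<and> F_TEAP k' \<Phi>' \<Psi>' U' \<phi> \<and> \<phi> < 1 \<and> Nc \<ge> 1 \<and>
          l2_norm (num_points k' Nc) (error_after k' Nc \<Phi>' \<Psi>' 1 e0)
            < l2_norm (num_points k' Nc) (error_after k' Nc \<Phi>' \<Psi>' 2 e0) \<and>
          AA_norm \<Phi>' (num_points k' Nc) (error_after k' Nc \<Phi>' \<Psi>' 1 e0)
            < AA_norm \<Phi>' (num_points k' Nc) (error_after k' Nc \<Phi>' \<Psi>' 2 e0))"
proof -
  obtain lam mu where "eigen_pair \<Phi> \<Psi> U lam mu k"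
    using time_stepping_pair_eigen_pair[OF assms] by blast
  then interpret eigen_pair \<Phi> \<Psi> U lam mu k .
  have example: "\<exists>(\<Phi>' :: complex^2^2) \<Psi>' U' k' \<phi> Nc e0.
      k' \<ge> 2 \<and> time_stepping_pair \<Phi>' \<Psi>' U' \<and> F_TEAP k' \<Phi>' \<Psi>' U' \<phi> \<and> \<phi> < 1 \<and> Nc \<ge> 1 \<and>
      l2_norm (num_points k' Nc) (error_after k' Nc \<Phi>' \<Psi>' 1 e0)
        < l2_norm (num_points k' Nc) (error_after k' Nc \<Phi>' \<Psi>' 2 e0) \<and>
      AA_norm \<Phi>' (num_points k' Nc) (error_after k' Nc \<Phi>' \<Psi>' 1 e0)
        < AA_norm \<Phi>' (num_points k' Nc) (error_after k' Nc \<Phi>' \<Psi>' 2 e0)"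
    using time_stepping_pair_ex F_TEAP_ex error_growth_ex
    by (intro exI[of _ Phi_ex] exI[of _ Psi_ex] exI[of _ U_ex] exI[of _ 2] exI[of _ "1/2"]
        exI[of _ 3] exI[of _ e0_ex]) auto
  have first: "(err Nc 1 e0)\<^sup>2 \<le> real k * (UU_norm U (num_points k Nc) e0)\<^sup>2"
    if "F_TEAP k \<Phi> \<Psi> U \<phi>" "\<phi> < 1" "Nc \<ge> 1" for \<phi> Nc e0
  proof -
    have "\<phi>\<^sup>2 \<le> 1" using F_TEAP_nonneg[OF that(1)] that(2) by (simp add: power_le_one)
    then have "\<phi>\<^sup>2 * (real k * (UU_norm U (num_points k Nc) e0)\<^sup>2)
        \<le> 1 * (real k * (UU_norm U (num_points k Nc) e0)\<^sup>2)"
      by (intro mult_right_mono) auto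
    then show ?thesis using err_one_le[OF that(1,3), of e0] by (simp add: mult.assoc)
  qed
  have later: "\<exists>\<epsilon>. order_term \<epsilon> \<and> (\<forall>Nc\<ge>1. \<forall>e0.
      (err Nc (p + 1) e0)\<^sup>2 \<le> (\<phi> ^ (2 * p) - \<epsilon> Nc) * (err Nc 1 e0)\<^sup>2)"
    if \<phi>: "F_TEAP k \<Phi> \<Psi> U \<phi>" and p: "p \<ge> 1" for \<phi> p
  proof -
    obtain c where "c > 0" "\<And>Nc e0. Nc \<ge> 1 \<Longrightarrow>
        (err Nc (p + 1) e0)\<^sup>2 \<le> (\<phi> ^ (2 * p) - c / (real Nc)\<^sup>2) * (err Nc 1 e0)\<^sup>2"
      using contraction_bound[OF \<phi> p] by blast
    then show ?thesis
      using order_term_inverse_square[of c] by (intro exI[of _ "\<lambda>Nc. c / (real Nc)\<^sup>2"]) blast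
  qed
  show ?thesis
    by (intro conjI allI impI; (elim conjE)?;
        rule first later bound_attained convergent_l2_norm_iff convergent_AA_norm_iff example; blast)
qed

end
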